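(* Let $f$ be a function analytic in the open unit disc $D$ such that $f'\in H^1$. Then for every $\eta\in T$, $$\int_T \frac{\left|f(\zeta\eta)-f(\overline{\zeta}\eta)\right|}{\left|1-\zeta\right|}\,dm(\zeta)\;\le\;\pi\,\|f'\|_{H^1}.$$
   Context: $D=\{\zeta\in\mathbb{C}:|\zeta|<1\}$ is the open unit disc, $T=\{\zeta\in\mathbb{C}:|\zeta|=1\}$ is the unit circle, and $m$ is normalized Lebesgue measure on $T$ (so $m(T)=1$). For $1\le p<\infty$, $H^p$ is the space of all functions $f$ analytic in $D$ with $$\|f\|_{H^p}=\sup_{0\le r<1}\left(\int_T|f(r\zeta)|^p\,dm(\zeta)\right)^{1/p}<\infty .$$ For points of $T$, the values of $f$ are its boundary values (when $f'\in H^1$, $f$ extends continuously to the closed disc $D\cup T$). *)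

theory Defs
  imports "HOL-Complex_Analysis.Complex_Analysis"
begin

definition circle_measure :: "complex measure" where
  "circle_measure =
     distr (uniform_measure lborel {0..2 * pi}) (restrict_space borel (sphere 0 1)) cis"

lemma cis_measurable_circle:
  "cis \<in> measurable (uniform_measure lborel {0..2 * pi}) (restrict_space borel (sphere 0 1))"
proof (rule measurable_restrict_space2)
  have "cis \<in> borel_measurable borel"
    by (intro borel_measurable_continuous_onI continuous_intros)
  then show "cis \<in> borel_measurable (uniform_measure lborel {0..2 * pi})"
    by (simp cong: measurable_cong_sets)
qed auto

lemma space_circle_measure: "space circle_measure = sphere 0 1"
  by (simp add: circle_measure_def space_restrict_space)

lemma emeasure_circle_measure_space: "emeasure circle_measure (sphere 0 1) = 1"
proof -
  have "emeasure circle_measure (sphere 0 1) =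
      emeasure (uniform_measure lborel {0..2 * pi}) (cis -` sphere 0 1 \<inter> UNIV)"
    unfolding circle_measure_def
    by (subst emeasure_distr[OF cis_measurable_circle])
       (auto simp: sets_restrict_space intro!: image_eqI[of _ _ UNIV])
  also have "cis -` sphere 0 1 \<inter> UNIV = UNIV"
    by auto
  also have "emeasure (uniform_measure lborel {0..2 * pi}) UNIV = 1"
    by (simp add: ennreal_divide_self)
  finally show ?thesis .
qed

definition hardy_mean :: "real \<Rightarrow> (complex \<Rightarrow> complex) \<Rightarrow> real \<Rightarrow> real" where
  "hardy_mean p f r =
     (LINT \<zeta>|circle_measure. norm (f (of_real r * \<zeta>)) powr p) powr (1 / p)"

(* For f continuous on the disc every mean is the integral of a bounded continuous function, so
   finiteness of the supremum of the means is exactly boundedness of the set of their real values.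
   The notions below are meant for 1 <= p. *)
definition hardy_norm :: "real \<Rightarrow> (complex \<Rightarrow> complex) \<Rightarrow> real" where
  "hardy_norm p f = (SUP r\<in>{0..<1}. hardy_mean p f r)"

definition hardy_space :: "real \<Rightarrow> (complex \<Rightarrow> complex) set" where
  "hardy_space p = {f. f holomorphic_on ball 0 1 \<and> bdd_above (hardy_mean p f ` {0..<1})}"

(* The value at \<zeta> of the continuous extension of f from the open disc; the limit is
   unrestricted within the disc, and values of the HOL function f outside the disc play no role. *)
definition boundary_value :: "(complex \<Rightarrow> complex) \<Rightarrow> complex \<Rightarrow> complex" where
  "boundary_value f \<zeta> = Lim (at \<zeta> within ball 0 1) f"

end

theory Submission imports Defs begin

text \<open>
  By rotation take \<open>\<eta> = 1\<close>. The points \<open>\<zeta>\<close> and \<open>cnj \<zeta>\<close> are joined by the circular arc through the disc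
  that is orthogonal to the real diameter and to the unit circle. In the coordinate \<open>w = s + \<i> * \<phi>\<close>,
  \<open>|\<phi>| < \<pi> / 2\<close>, on a strip that is mapped to the disc by \<open>w \<mapsto> (1 - exp w) / (1 + exp w)\<close>
  (\<open>disc_of_strip\<close>), these arcs are the vertical cross sections. If \<open>g\<close> denotes \<open>f\<close> in this coordinate, then \<open>|f \<zeta> - f (cnj \<zeta>)|\<close> is at most the
  integral of \<open>|g'|\<close> over a cross section, and for \<open>\<zeta> = cis \<theta>\<close> with \<open>0 < \<theta> < \<pi>\<close> one has
  \<open>ds = d\<theta> / sin \<theta>\<close>, where \<open>sin \<theta> \<le> |1 - \<zeta>|\<close>. Hence the integral over the upper half circle is at most
  the integral of \<open>|g'|\<close> over the strip, divided by \<open>2 * \<pi>\<close>.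

  That area integral is evaluated along horizontal lines. Let \<open>I \<phi>\<close> be the integral of \<open>|g'|\<close> over the
  line of height \<open>\<phi>\<close>. The Poisson majorant of \<open>|g'|\<close> gives
  \<open>I \<phi> + I (- \<phi>) \<le> 2 * \<pi> * hardy_norm 1 f'\<close> (\<open>line_integrals\<close>), which for \<open>\<phi> = 0\<close> is the
  Fejer-Riesz inequality. Here it is essential that \<open>g'\<close> is \<open>f'\<close> times the derivative of the coordinate
  change, so that the majorant is integrated against the harmonic measure of the strip, which is affine
  in \<open>\<phi>\<close>. Integrating over \<open>0 < \<phi> < \<pi> / 2\<close> bounds the area integral by \<open>\<pi>\<^sup>2 * hardy_norm 1 f'\<close>, and the
  two half circles together give \<open>\<pi> * hardy_norm 1 f'\<close>.

  The same bound shows that \<open>f\<close> has an unrestricted limit at every point of the circle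
  (\<open>tendsto_boundary_value\<close>). The end of the strip is approached through cross sections on which \<open>g\<close> is
  nearly constant, and by the maximum principle any oscillation of \<open>g\<close> between them costs a fixed amount
  of variation along lines near the edges of the strip, whose total variation is bounded
  (\<open>strip_end_limit\<close>). With the boundary values at hand, the estimate on lines inside the strip passes to
  the edges by Fatou's lemma (\<open>half_circle_bound\<close>).
\<close>

section \<open>Poisson majorant of the modulus of a holomorphic function\<close>

text \<open>
  Dividing \<open>G\<close> by \<open>1 - cnj z * u\<close> before applying Cauchy's formula turns the Cauchy kernel into
  one of modulus \<open>1 / |u - z|\<^sup>2\<close> on the circle, because there \<open>|1 - cnj z * u| = |u - z|\<close>. Taking
  absolute values inside the integral therefore leaves exactly the Poisson kernel.
\<close>
lemma poisson_majorant:
  assumes hol: "G holomorphic_on ball 0 R" and R: "1 < R" and z: "norm z < 1"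
  shows "2 * pi * norm (G z)
    \<le> integral {0..2 * pi} (\<lambda>t. norm (G (cis t)) * ((1 - (norm z)\<^sup>2) / (norm (cis t - z))\<^sup>2))"
proof -
  define k where "k u = G u / (1 - cnj z * u)" for u
  have nz: "1 - cnj z * u \<noteq> 0" if "norm u \<le> 1" for u
  proof
    assume "1 - cnj z * u = 0"
    then have "norm (cnj z * u) = 1" by (metis eq_iff_diff_eq_0 norm_one)
    moreover have "norm (cnj z * u) \<le> norm z" using that
      by (simp add: norm_mult mult_left_le)
    ultimately show False using z by simp
  qed
  have holG: "G holomorphic_on cball 0 1"
    using hol R by (rule_tac holomorphic_on_subset) auto
  have holk: "k holomorphic_on cball 0 1"
    unfolding k_def using nz by (intro holomorphic_intros holG) auto
  have "((\<lambda>u. k u / (u - z)) has_contour_integral (2 * of_real pi * \<i> * k z)) (circlepath 0 1)"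
    using z by (intro Cauchy_integral_circlepath holomorphic_on_imp_continuous_on[OF holk]
        holomorphic_on_subset[OF holk]) auto
  then have hi: "((\<lambda>t. k (cis t) / (cis t - z) * \<i> * cis t) has_integral
      (2 * of_real pi * \<i> * k z)) {0..2 * pi}"
    unfolding circlepath_def by (subst (asm) has_contour_integral_part_circlepath_iff) auto
  have ne: "cis t \<noteq> z" for t using z by auto
  define q where "q t = norm (G (cis t)) / (norm (cis t - z))\<^sup>2" for t
  have eq: "norm (k (cis t) / (cis t - z) * \<i> * cis t) = q t" for t
  proof -
    have "1 - cnj z * cis t = cis t * cnj (cis t - z)"
      by (simp add: algebra_simps cis_cnj cis_mult)
    then have "norm (1 - cnj z * cis t) = norm (cis t - z)"
      by (metis complex_mod_cnj mult_1 norm_cis norm_mult)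
    then show ?thesis
      by (simp add: k_def q_def norm_mult norm_divide power2_eq_square)
  qed
  have contq: "continuous_on {0..2 * pi} q"
    unfolding q_def using ne
    by (intro continuous_intros continuous_on_compose2[OF holomorphic_on_imp_continuous_on[OF holG]])
       (auto intro!: continuous_intros)
  have "norm (2 * of_real pi * \<i> * k z) \<le> integral {0..2 * pi} q"
    using integral_norm_bound_integral[OF has_integral_integrable[OF hi]
        integrable_continuous_real[OF contq]] eq hi
    by (simp add: integral_unique)
  moreover have "norm (k z) = norm (G z) / (1 - (norm z)\<^sup>2)"
  proof -
    have "1 - cnj z * z = of_real (1 - (norm z)\<^sup>2)"
      by (simp only: of_real_diff of_real_1 complex_norm_square mult.commute)
    moreover have "0 < 1 - (norm z)\<^sup>2" using z by (simp add: power_less_one_iff abs_square_less_1)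
    ultimately show ?thesis
      by (simp only: k_def norm_divide norm_of_real)
  qed
  moreover have p: "0 < 1 - (norm z)\<^sup>2" using z by (simp add: power_less_one_iff abs_square_less_1)
  ultimately have "2 * pi * norm (G z) \<le> (1 - (norm z)\<^sup>2) * integral {0..2 * pi} q"
    by (simp add: norm_mult field_simps)
  also have "\<dots> = integral {0..2 * pi} (\<lambda>t. (1 - (norm z)\<^sup>2) * q t)"
    by simp
  also have "\<dots> = integral {0..2 * pi} (\<lambda>t. norm (G (cis t)) * ((1 - (norm z)\<^sup>2) / (norm (cis t - z))\<^sup>2))"
    by (rule arg_cong[where f="integral _"]) (auto simp: q_def)
  finally show ?thesis .
qed

section \<open>Strip coordinates on the disc\<close>

definition strip :: "complex set" where "strip = {w. \<bar>Im w\<bar> < pi / 2}"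

text \<open>
  The exponential followed by a Cayley transform. The left end of the strip corresponds to the point
  \<open>1\<close> of the circle, the right end to \<open>-1\<close>, and the two edges to the two half circles.
\<close>
definition disc_of_strip :: "complex \<Rightarrow> complex"
  where "disc_of_strip w = (1 - exp w) / (1 + exp w)"

lemma Re_exp_pos: "w \<in> strip \<Longrightarrow> 0 < Re (exp w)"
  by (auto simp: strip_def Re_exp abs_less_iff intro!: mult_pos_pos cos_gt_zero_pi)

lemma one_plus_nonzero: "0 < Re u \<Longrightarrow> 1 + u \<noteq> 0"
  by (auto simp: complex_eq_iff)

lemma one_minus_norm_cayley:
  assumes "0 < Re u"
  shows "1 - (norm ((1 - u) / (1 + u)))\<^sup>2 = 4 * Re u / (norm (1 + u))\<^sup>2"
proof -
  have "(norm (1 + u))\<^sup>2 \<noteq> 0" using one_plus_nonzero[OF assms] by simp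
  then have "1 - (norm ((1 - u) / (1 + u)))\<^sup>2 = ((norm (1 + u))\<^sup>2 - (norm (1 - u))\<^sup>2) / (norm (1 + u))\<^sup>2"
    by (simp only: norm_divide power_divide) (simp add: diff_divide_distrib)
  also have "(norm (1 + u))\<^sup>2 - (norm (1 - u))\<^sup>2 = 4 * Re u"
    unfolding cmod_power2 by (simp add: power2_eq_square algebra_simps)
  finally show ?thesis .
qed

lemma disc_of_strip_in_ball: assumes "w \<in> strip" shows "norm (disc_of_strip w) < 1"
proof -
  note p = Re_exp_pos[OF assms]
  have "0 < 1 - (norm (disc_of_strip w))\<^sup>2"
    unfolding disc_of_strip_def one_minus_norm_cayley[OF p]
    using p one_plus_nonzero[OF p] by simp
  then show ?thesis by (simp add: abs_square_less_1)
qed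

lemma has_field_derivative_disc_of_strip:
  assumes "w \<in> strip"
  shows "(disc_of_strip has_field_derivative - (1 - (disc_of_strip w)\<^sup>2) / 2) (at w)"
proof -
  have n: "1 + exp w \<noteq> 0" by (rule one_plus_nonzero[OF Re_exp_pos[OF assms]])
  show ?thesis
    unfolding disc_of_strip_def
    apply (rule derivative_eq_intros refl n)+
    using n by (simp add: divide_simps power2_eq_square) algebra
qed

lemma open_strip: "open strip"
proof -
  have "strip = {w. Im w < pi / 2} \<inter> {w. - (pi / 2) < Im w}" by (auto simp: strip_def abs_less_iff)
  then show ?thesis
    using open_Int[OF open_halfspace_Im_lt[of "pi / 2"] open_halfspace_Im_gt[of "- (pi / 2)"]] by (simp only:)
qed

lemma disc_of_strip_holomorphic: "disc_of_strip holomorphic_on strip"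
  using has_field_derivative_disc_of_strip holomorphic_on_open[OF open_strip] by blast

section \<open>The Poisson kernel in strip coordinates\<close>

text \<open>
  The Poisson kernel of the disc at the point with strip coordinate \<open>w\<close>, weighted by the modulus
  \<open>|1 - \<zeta>\<^sup>2| / 2\<close> of the derivative of the coordinate change at the boundary point \<open>\<zeta>\<close>.
\<close>
definition strip_kernel :: "complex \<Rightarrow> complex \<Rightarrow> real" where
  "strip_kernel \<zeta> w = norm (1 - \<zeta>\<^sup>2) / 2 *
     ((1 - (norm (disc_of_strip w))\<^sup>2) / (norm (\<zeta> - disc_of_strip w))\<^sup>2)"

lemma cayley_kernel:
  fixes y :: real
  assumes u: "0 < Re u" and \<zeta>: "\<zeta> = (1 - \<i> * y) / (1 + \<i> * y)" and z: "z = (1 - u) / (1 + u)"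
  shows "norm (1 - \<zeta>\<^sup>2) / 2 * ((1 - (norm z)\<^sup>2) / (norm (\<zeta> - z))\<^sup>2)
       = 2 * \<bar>y\<bar> * Re u / (norm (u - \<i> * y))\<^sup>2"
proof -
  have nu: "1 + u \<noteq> 0" by (rule one_plus_nonzero[OF u])
  have ny: "1 + \<i> * y \<noteq> 0" by (auto simp: complex_eq_iff)
  have nd: "u - \<i> * y \<noteq> 0" using u by (auto simp: complex_eq_iff)
  have e1: "1 - \<zeta>\<^sup>2 = 4 * (\<i> * y) / (1 + \<i> * y)\<^sup>2"
    unfolding \<zeta> using ny by (simp add: divide_simps) algebra
  have n1: "norm (1 - \<zeta>\<^sup>2) = 4 * \<bar>y\<bar> / (norm (1 + \<i> * y))\<^sup>2"
    unfolding e1 by (simp add: norm_divide norm_mult norm_power)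
  have e2: "\<zeta> - z = 2 * (u - \<i> * y) / ((1 + u) * (1 + \<i> * y))"
    unfolding \<zeta> z using nu ny by (simp add: divide_simps) algebra
  have n2: "norm (\<zeta> - z) = 2 * norm (u - \<i> * y) / (norm (1 + u) * norm (1 + \<i> * y))"
    unfolding e2 by (simp only: norm_divide norm_mult norm_numeral)
  have n3: "1 - (norm z)\<^sup>2 = 4 * Re u / (norm (1 + u))\<^sup>2"
    unfolding z by (rule one_minus_norm_cayley[OF u])
  have "norm (1 + u) \<noteq> 0" "norm (1 + \<i> * y) \<noteq> 0" "norm (u - \<i> * y) \<noteq> 0"
    using nu ny nd by auto
  then show ?thesis
    unfolding n1 n2 n3 by (simp add: field_simps power2_eq_square)
qed

lemma circle_cayley:
  assumes "norm \<zeta> = 1" "\<zeta> \<noteq> -1"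
  obtains y :: real where "\<zeta> = (1 - \<i> * y) / (1 + \<i> * y)"
proof -
  define y where "y = - Im \<zeta> / (1 + Re \<zeta>)"
  have s: "(Re \<zeta>)\<^sup>2 + (Im \<zeta>)\<^sup>2 = 1" using assms(1) by (metis cmod_power2 one_power2)
  have r: "1 + Re \<zeta> \<noteq> 0"
  proof
    assume "1 + Re \<zeta> = 0"
    then have "Re \<zeta> = -1" by simp
    with s have "Im \<zeta> = 0" by simp
    with \<open>Re \<zeta> = -1\<close> assms(2) show False by (simp add: complex_eq_iff)
  qed
  have ny: "1 + \<i> * y \<noteq> 0" by (auto simp: complex_eq_iff)
  have "\<zeta> * (1 + \<i> * y) = 1 - \<i> * y"
    using r s unfolding y_def by (auto simp: complex_eq_iff field_simps power2_eq_square)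
  then have "\<zeta> = (1 - \<i> * y) / (1 + \<i> * y)" using ny by (simp add: nonzero_eq_divide_eq)
  then show ?thesis by (rule that)
qed

text \<open>
  In the half plane of \<open>u = exp w\<close>, with \<open>\<zeta>\<close> the Cayley image of \<open>\<i> * Y\<close>, the weighted Poisson kernel is
  \<open>2 * Y * Re u / |u - \<i> * Y|\<^sup>2\<close>; this is its value at \<open>u = exp (s + \<i> * \<phi>)\<close>, with the
  denominator written so that the kernel is visibly the derivative of an arctangent.
\<close>
definition arctan_kernel :: "real \<Rightarrow> real \<Rightarrow> real \<Rightarrow> real" where
  "arctan_kernel Y \<phi> s =
     2 * Y * (exp s * cos \<phi>) / ((exp s - Y * sin \<phi>)\<^sup>2 + (Y * cos \<phi>)\<^sup>2)"

text \<open>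
  Over the whole line the arctangent rises from \<open>- \<phi>\<close> to \<open>\<pi> / 2\<close>. The bound is affine in \<open>\<phi>\<close> since
  it is \<open>2 * \<pi>\<close> times the harmonic measure of one edge of the strip.
\<close>
lemma arctan_kernel_integral:
  assumes Y: "0 < Y" and \<phi>: "\<bar>\<phi>\<bar> < pi / 2" and ab: "a \<le> b"
  shows "integral {a..b} (arctan_kernel Y \<phi>) \<le> pi + 2 * \<phi>"
proof -
  define A where "A s = 2 * arctan ((exp s - Y * sin \<phi>) / (Y * cos \<phi>))" for s
  have c: "0 < cos \<phi>" using \<phi> by (intro cos_gt_zero_pi) auto
  have d: "(A has_real_derivative arctan_kernel Y \<phi> s) (at s)" for s
  proof -
    have p: "0 < (exp s - Y * sin \<phi>)\<^sup>2 + (Y * cos \<phi>)\<^sup>2" using c Y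
      by (intro add_nonneg_pos) auto
    have "(A has_real_derivative
       2 * ((exp s / (Y * cos \<phi>)) * inverse (1 + ((exp s - Y * sin \<phi>) / (Y * cos \<phi>))\<^sup>2))) (at s)"
      unfolding A_def using c Y by (auto intro!: derivative_eq_intros simp: field_simps)
    moreover have "2 * ((exp s / (Y * cos \<phi>)) * inverse (1 + ((exp s - Y * sin \<phi>) / (Y * cos \<phi>))\<^sup>2))
       = arctan_kernel Y \<phi> s"
    proof -
      have "1 + ((exp s - Y * sin \<phi>) / (Y * cos \<phi>))\<^sup>2
          = ((exp s - Y * sin \<phi>)\<^sup>2 + (Y * cos \<phi>)\<^sup>2) / (Y * cos \<phi>)\<^sup>2"
        using c Y by (simp add: field_simps)
      then show ?thesis using c Y p unfolding arctan_kernel_def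
        by (simp add: power2_eq_square)
    qed
    ultimately show ?thesis by simp
  qed
  have hi: "(arctan_kernel Y \<phi> has_integral (A b - A a)) {a..b}"
    by (rule fundamental_theorem_of_calculus[OF ab])
       (use d in \<open>auto simp: has_real_derivative_iff_has_vector_derivative[symmetric]
          intro: DERIV_subset\<close>)
  have "A b \<le> pi" unfolding A_def using arctan_ubound[of "(exp b - Y * sin \<phi>) / (Y * cos \<phi>)"] by linarith
  moreover have "A a \<ge> - 2 * \<phi>"
  proof -
    have "(exp a - Y * sin \<phi>) / (Y * cos \<phi>) \<ge> (- (Y * sin \<phi>)) / (Y * cos \<phi>)"
      using c Y by (intro divide_right_mono) auto
    also have "(- (Y * sin \<phi>)) / (Y * cos \<phi>) = tan (- \<phi>)" using Y by (simp add: tan_def)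
    finally have "arctan ((exp a - Y * sin \<phi>) / (Y * cos \<phi>)) \<ge> arctan (tan (- \<phi>))"
      by (simp add: arctan_le_iff)
    also have "arctan (tan (- \<phi>)) = - \<phi>" using \<phi> by (intro arctan_tan) auto
    finally show ?thesis by (simp add: A_def)
  qed
  ultimately show "integral {a..b} (arctan_kernel Y \<phi>) \<le> pi + 2 * \<phi>"
    using integral_unique[OF hi] by linarith
qed

text \<open>
  The bounds \<open>\<pi> + 2 * \<phi>\<close> and \<open>\<pi> - 2 * \<phi>\<close> for the two lines add up to a constant, whichever half circle
  contains \<open>\<zeta>\<close>. This cancellation is the source of the constant \<open>\<pi>\<close> in the final estimate.
\<close>
lemma strip_kernel_lines:
  assumes \<zeta>: "norm \<zeta> = 1" and \<phi>: "\<bar>\<phi>\<bar> < pi / 2" and ab: "a \<le> b"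
  shows "integral {a..b} (\<lambda>s. strip_kernel \<zeta> (Complex s \<phi>))
       + integral {a..b} (\<lambda>s. strip_kernel \<zeta> (Complex s (- \<phi>))) \<le> 2 * pi"
proof (cases "\<zeta> = 1 \<or> \<zeta> = -1")
  case True
  then show ?thesis by (auto simp: strip_kernel_def)
next
  case False
  with \<zeta> obtain y :: real where y: "\<zeta> = (1 - \<i> * y) / (1 + \<i> * y)"
    by (meson circle_cayley)
  with False have y0: "y \<noteq> 0" by auto
  \<comment> \<open>Complex conjugation reduces negative \<open>y\<close> to positive ones, replacing the height \<open>\<psi>\<close> by \<open>- \<psi>\<close>.\<close>
  have k: "strip_kernel \<zeta> (Complex s \<psi>) = arctan_kernel \<bar>y\<bar> (sgn y * \<psi>) s"
    if "\<bar>\<psi>\<bar> < pi / 2" for s \<psi>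
  proof -
    have p: "0 < Re (exp (Complex s \<psi>))"
      by (rule Re_exp_pos) (use that in \<open>simp add: strip_def\<close>)
    have "strip_kernel \<zeta> (Complex s \<psi>) =
        2 * \<bar>y\<bar> * Re (exp (Complex s \<psi>)) / (norm (exp (Complex s \<psi>) - \<i> * y))\<^sup>2"
      unfolding strip_kernel_def
      by (rule cayley_kernel[OF p y]) (simp add: disc_of_strip_def)
    also have "(norm (exp (Complex s \<psi>) - \<i> * y))\<^sup>2
       = (exp s - y * sin \<psi>)\<^sup>2 + (y * cos \<psi>)\<^sup>2"
    proof -
      have "(norm (exp (Complex s \<psi>) - \<i> * y))\<^sup>2 = (exp s * cos \<psi>)\<^sup>2 + (exp s * sin \<psi> - y)\<^sup>2"
        by (simp add: cmod_power2 Re_exp Im_exp)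
      then show ?thesis
        using sin_cos_squared_add[of \<psi>] by algebra
    qed
    also have "\<dots> = (exp s - \<bar>y\<bar> * sin (sgn y * \<psi>))\<^sup>2 + (\<bar>y\<bar> * cos (sgn y * \<psi>))\<^sup>2"
      by (cases "y > 0") (use y0 in \<open>auto simp: sgn_if\<close>)
    also have "Re (exp (Complex s \<psi>)) = exp s * cos (sgn y * \<psi>)"
      by (cases "y > 0") (use y0 in \<open>auto simp: sgn_if Re_exp\<close>)
    finally show ?thesis by (simp add: arctan_kernel_def mult.assoc)
  qed
  have s1: "\<bar>sgn y * \<phi>\<bar> < pi / 2" "\<bar>sgn y * - \<phi>\<bar> < pi / 2"
    using \<phi> y0 by (auto simp: abs_mult)
  have yp: "0 < \<bar>y\<bar>" using y0 by simp
  show ?thesis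
    using arctan_kernel_integral[OF yp s1(1) ab] arctan_kernel_integral[OF yp s1(2) ab]
      k[OF \<phi>] k[of "- \<phi>"] \<phi>
    by (simp cong: integral_cong)
qed

section \<open>A Fejer-Riesz inequality for horizontal lines of the strip\<close>

lemma Complex_in_strip: "\<bar>\<phi>\<bar> < pi / 2 \<Longrightarrow> Complex s \<phi> \<in> strip"
  by (simp add: strip_def)

lemma continuous_on_disc_of_strip:
  assumes "continuous_on A h" "\<And>x. x \<in> A \<Longrightarrow> h x \<in> strip"
  shows "continuous_on A (\<lambda>x. disc_of_strip (h x))"
  using continuous_on_compose2[OF holomorphic_on_imp_continuous_on[OF disc_of_strip_holomorphic]] assms
  by blast

text \<open>
  The factor \<open>1 - (u / \<eta>)\<^sup>2\<close> is carried through the Poisson majorant. Inside the disc it becomes the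
  derivative of the coordinate change, on the circle it becomes the weight of the kernel. Without
  it, the integrals of the kernel along the lines would be unbounded as the point of the circle
  approaches \<open>\<plusminus>\<eta>\<close>, the common end points of all lines. The dilation by \<open>\<rho>\<close> makes the function holomorphic across the circle.
\<close>
lemma line_majorant:
  assumes F: "F holomorphic_on ball 0 1" and \<rho>: "0 < \<rho>" "\<rho> < 1" and \<eta>: "norm \<eta> = 1"
    and w: "w \<in> strip"
  shows "2 * pi * (norm (F (of_real \<rho> * \<eta> * disc_of_strip w)) * (norm (1 - (disc_of_strip w)\<^sup>2) / 2))
    \<le> integral {0..2 * pi} (\<lambda>t. norm (F (of_real \<rho> * cis t)) * strip_kernel (cis t / \<eta>) w)"
proof -
  define G where "G u = F (of_real \<rho> * u) * (1 - (u / \<eta>)\<^sup>2) / 2" for u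
  have \<eta>0: "\<eta> \<noteq> 0" using \<eta> by auto
  have "G holomorphic_on ball 0 (1 / \<rho>)"
    unfolding G_def using \<eta>0 \<rho>
    by (intro holomorphic_intros holomorphic_on_compose_gen[OF _ F, unfolded o_def])
       (auto simp: norm_mult field_simps)
  then have "2 * pi * norm (G (\<eta> * disc_of_strip w))
    \<le> integral {0..2 * pi} (\<lambda>t. norm (G (cis t)) * ((1 - (norm (\<eta> * disc_of_strip w))\<^sup>2)
         / (norm (cis t - \<eta> * disc_of_strip w))\<^sup>2))"
    by (rule poisson_majorant) (use \<rho> \<eta> disc_of_strip_in_ball[OF w] in \<open>auto simp: norm_mult\<close>)
  moreover have "norm (cis t - \<eta> * disc_of_strip w) = norm (cis t / \<eta> - disc_of_strip w)" for t
  proof -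
    have "cis t - \<eta> * disc_of_strip w = \<eta> * (cis t / \<eta> - disc_of_strip w)"
      using \<eta>0 by (simp add: algebra_simps)
    then show ?thesis by (simp only: norm_mult \<eta> mult_1)
  qed
  ultimately show ?thesis
    unfolding G_def strip_kernel_def using \<eta> \<eta>0
    by (simp add: norm_mult norm_divide mult.assoc mult.commute mult.left_commute)
qed

text \<open>
  Integrating the majorant along the two lines and exchanging the integrals leaves, for each point of
  the circle, the sum of kernel integrals bounded in \<open>strip_kernel_lines\<close>. For \<open>\<phi> = 0\<close> this is the
  Fejer-Riesz inequality: twice the integral of \<open>|F|\<close> over a diameter is at most that over the circle.
\<close>
lemma line_integrals_dilated:
  assumes F: "F holomorphic_on ball 0 1" and \<rho>: "0 < \<rho>" "\<rho> < 1" and \<eta>: "norm \<eta> = 1"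
    and \<phi>: "\<bar>\<phi>\<bar> < pi / 2" and ab: "a \<le> b"
  defines "L \<equiv> \<lambda>w. norm (F (of_real \<rho> * \<eta> * disc_of_strip w)) * (norm (1 - (disc_of_strip w)\<^sup>2) / 2)"
  shows "integral {a..b} (\<lambda>s. L (Complex s \<phi>)) + integral {a..b} (\<lambda>s. L (Complex s (- \<phi>)))
     \<le> integral {0..2 * pi} (\<lambda>t. norm (F (of_real \<rho> * cis t)))"
proof -
  have \<eta>0: "\<eta> \<noteq> 0" using \<eta> by auto
  define N where "N t = norm (F (of_real \<rho> * cis t))" for t
  have contF: "continuous_on (ball 0 1) F" by (rule holomorphic_on_imp_continuous_on[OF F])
  have contN: "continuous_on A N" for A
    unfolding N_def using \<rho>
    by (intro continuous_intros continuous_on_compose2[OF contF]) (auto simp: norm_mult)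
  have one: "2 * pi * integral {a..b} (\<lambda>s. L (Complex s \<psi>))
       \<le> integral {0..2 * pi} (\<lambda>t. N t * integral {a..b} (\<lambda>s. strip_kernel (cis t / \<eta>) (Complex s \<psi>)))"
    and kc: "continuous_on {0..2 * pi} (\<lambda>t. integral {a..b} (\<lambda>s. strip_kernel (cis t / \<eta>) (Complex s \<psi>)))"
    if \<psi>: "\<bar>\<psi>\<bar> < pi / 2" for \<psi>
  proof -
    note inS = Complex_in_strip[OF \<psi>]
    have ne: "cis t / \<eta> \<noteq> disc_of_strip (Complex s \<psi>)" for s t
      using disc_of_strip_in_ball[OF inS, of s] \<eta> by (auto simp: norm_divide dest!: sym[of "cis t / \<eta>"])
    have c1: "continuous_on A (\<lambda>x. disc_of_strip (Complex (h x) \<psi>))" if "continuous_on A h"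
      for h and A :: "'b::topological_space set"
      using that inS by (intro continuous_on_disc_of_strip) (auto intro!: continuous_intros)
    have ck: "continuous_on A (\<lambda>x. strip_kernel (cis (k x) / \<eta>) (Complex (h x) \<psi>))"
      if "continuous_on A h" "continuous_on A k" for h k and A :: "'b::topological_space set"
      unfolding strip_kernel_def using that \<eta>0 ne by (intro continuous_intros c1) auto
    have inb: "norm (of_real \<rho> * \<eta> * disc_of_strip (Complex s \<psi>)) < 1" for s
    proof -
      have "\<rho> * norm (disc_of_strip (Complex s \<psi>)) \<le> norm (disc_of_strip (Complex s \<psi>))"
        using \<rho> by (intro mult_left_le_one_le) auto
      then show ?thesis using disc_of_strip_in_ball[OF inS, of s] \<rho> \<eta> by (simp add: norm_mult)
    qed
    have cL: "continuous_on {a..b} (\<lambda>s. L (Complex s \<psi>))"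
      unfolding L_def using \<rho> \<eta> disc_of_strip_in_ball[OF inS]
      by (intro continuous_intros continuous_on_compose2[OF contF] c1)
         (use inb inS in auto)
    define k where "k s t = N t * strip_kernel (cis t / \<eta>) (Complex s \<psi>)" for s t
    have ck2: "continuous_on (cbox (a, 0) (b, 2 * pi)) (\<lambda>(s, t). k s t)"
      unfolding k_def split_beta
      by (intro continuous_intros ck continuous_on_compose2[OF contN[of UNIV]]) auto
    have ck2': "continuous_on ({0..2 * pi} \<times> cbox a b)
        (\<lambda>(t, s). strip_kernel (cis t / \<eta>) (Complex s \<psi>))"
      unfolding split_beta by (intro ck) (auto intro!: continuous_intros)
    have "continuous_on {a..b} (\<lambda>s. integral (cbox 0 (2 * pi)) (k s))"
      using ck2 by (intro integral_continuous_on_param) (simp add: cbox_Pair_eq)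
    then have ci: "(\<lambda>s. integral (cbox 0 (2 * pi)) (k s)) integrable_on {a..b}"
      by (rule integrable_continuous_real)
    show kc: "continuous_on {0..2 * pi} (\<lambda>t. integral {a..b} (\<lambda>s. strip_kernel (cis t / \<eta>) (Complex s \<psi>)))"
      using integral_continuous_on_param[OF ck2'] by simp
    have "2 * pi * integral {a..b} (\<lambda>s. L (Complex s \<psi>)) = integral {a..b} (\<lambda>s. 2 * pi * L (Complex s \<psi>))"
      by simp
    also have "\<dots> \<le> integral {a..b} (\<lambda>s. integral (cbox 0 (2 * pi)) (k s))"
      using line_majorant[OF F \<rho> \<eta> inS]
      by (intro integral_le ci integrable_continuous_real continuous_on_mult_left cL)
         (auto simp: L_def k_def[abs_def] N_def)
    also have "\<dots> = integral (cbox 0 (2 * pi)) (\<lambda>t. integral (cbox a b) (\<lambda>s. k s t))"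
      using integral_swap_continuous[OF ck2] by simp
    also have "\<dots> = integral {0..2 * pi} (\<lambda>t. N t * integral {a..b} (\<lambda>s. strip_kernel (cis t / \<eta>) (Complex s \<psi>)))"
      by (simp add: k_def)
    finally show "2 * pi * integral {a..b} (\<lambda>s. L (Complex s \<psi>)) \<le> \<dots>" .
  qed
  have \<phi>': "\<bar>- \<phi>\<bar> < pi / 2" using \<phi> by simp
  let ?K = "\<lambda>\<psi> t. integral {a..b} (\<lambda>s. strip_kernel (cis t / \<eta>) (Complex s \<psi>))"
  have "2 * pi * (integral {a..b} (\<lambda>s. L (Complex s \<phi>)) + integral {a..b} (\<lambda>s. L (Complex s (- \<phi>))))
     \<le> integral {0..2 * pi} (\<lambda>t. N t * ?K \<phi> t) + integral {0..2 * pi} (\<lambda>t. N t * ?K (- \<phi>) t)"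
    using one[OF \<phi>] one[OF \<phi>'] by (simp add: distrib_left)
  also have "\<dots> = integral {0..2 * pi} (\<lambda>t. N t * ?K \<phi> t + N t * ?K (- \<phi>) t)"
    by (intro integral_add[symmetric] integrable_continuous_real continuous_on_mult contN kc \<phi> \<phi>')
  also have "\<dots> \<le> integral {0..2 * pi} (\<lambda>t. N t * (2 * pi))"
  proof (intro integral_le integrable_continuous_real continuous_on_mult continuous_on_add contN kc \<phi> \<phi>' continuous_on_const)
    fix t
    have "?K \<phi> t + ?K (- \<phi>) t \<le> 2 * pi"
      using \<eta> \<phi> ab by (intro strip_kernel_lines) (auto simp: norm_divide)
    then show "N t * ?K \<phi> t + N t * ?K (- \<phi>) t \<le> N t * (2 * pi)"
      unfolding distrib_left[symmetric] by (intro mult_left_mono) (auto simp: N_def)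
  qed
  also have "\<dots> = 2 * pi * integral {0..2 * pi} N" by simp
  finally show ?thesis by (simp add: N_def[abs_def])
qed

text \<open>
  The passage \<open>\<rho> \<rightarrow> 1\<close> is harmless because the segments of the two lines are compact subsets of the
  open strip.
\<close>
lemma line_integrals:
  assumes F: "F holomorphic_on ball 0 1" and \<eta>: "norm \<eta> = 1"
    and C: "\<And>r. 0 < r \<Longrightarrow> r < 1 \<Longrightarrow> integral {0..2 * pi} (\<lambda>t. norm (F (of_real r * cis t))) \<le> C"
    and \<phi>: "\<bar>\<phi>\<bar> < pi / 2" and ab: "a \<le> b"
  defines "L \<equiv> \<lambda>w. norm (F (\<eta> * disc_of_strip w)) * (norm (1 - (disc_of_strip w)\<^sup>2) / 2)"
  shows "integral {a..b} (\<lambda>s. L (Complex s \<phi>)) + integral {a..b} (\<lambda>s. L (Complex s (- \<phi>))) \<le> C"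
proof -
  define L' where "L' \<rho> w = norm (F (of_real \<rho> * \<eta> * disc_of_strip w)) * (norm (1 - (disc_of_strip w)\<^sup>2) / 2)"
    for \<rho> w
  have contF: "continuous_on (ball 0 1) F" by (rule holomorphic_on_imp_continuous_on[OF F])
  have c: "continuous_on {0..1} (\<lambda>\<rho>. integral {a..b} (\<lambda>s. L' \<rho> (Complex s \<psi>)))"
    if "\<bar>\<psi>\<bar> < pi / 2" for \<psi>
  proof -
    note inS = Complex_in_strip[OF that]
    have b: "norm (of_real \<rho> * \<eta> * disc_of_strip (Complex s \<psi>)) < 1" if "\<rho> \<in> {0..1}" for \<rho> s
      using that \<eta> mult_left_le_one_le[of "norm (disc_of_strip (Complex s \<psi>))" \<rho>]
        disc_of_strip_in_ball[OF inS, of s]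
      by (simp add: norm_mult)
    have "continuous_on ({0..1} \<times> cbox a b) (\<lambda>(\<rho>, s). L' \<rho> (Complex s \<psi>))"
      unfolding L'_def split_beta using inS b
      by (intro continuous_intros continuous_on_compose2[OF contF] continuous_on_disc_of_strip)
         (auto intro!: continuous_intros)
    from integral_continuous_on_param[OF this] show ?thesis by simp
  qed
  let ?J = "\<lambda>\<rho>. integral {a..b} (\<lambda>s. L' \<rho> (Complex s \<phi>)) + integral {a..b} (\<lambda>s. L' \<rho> (Complex s (- \<phi>)))"
  have "continuous_on {0..1} ?J" using \<phi> by (intro continuous_on_add c) auto
  then have "(?J \<longlongrightarrow> ?J 1) (at 1 within {0..1})" by (simp add: continuous_on_def)
  then have "(?J \<longlongrightarrow> ?J 1) (at_left 1)"
    by (simp add: at_within_Icc_at_left)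
  moreover have "eventually (\<lambda>\<rho>. ?J \<rho> \<le> C) (at_left 1)"
    using eventually_at_left_real[OF zero_less_one]
    by eventually_elim
       (unfold L'_def, intro order_trans[OF line_integrals_dilated[OF F _ _ \<eta> \<phi> ab]] C, auto)
  ultimately have "?J 1 \<le> C" by (intro tendsto_upperbound) auto
  then show ?thesis by (simp add: L'_def L_def)
qed

section \<open>Functions of bounded variation along the lines of the strip\<close>

definition line_variation :: "(complex \<Rightarrow> complex) \<Rightarrow> real \<Rightarrow> real \<Rightarrow> real \<Rightarrow> real" where
  "line_variation g \<phi> a b = integral {a..b} (\<lambda>s. norm (deriv g (Complex s \<phi>)))"

lemma increment_along_unit_speed:
  assumes g: "g holomorphic_on strip"
    and \<gamma>: "\<And>t. t \<in> {a..b} \<Longrightarrow> (\<gamma> has_vector_derivative d) (at t)" "norm d = 1"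
    and inS: "\<And>t. t \<in> {a..b} \<Longrightarrow> \<gamma> t \<in> strip" and ab: "a \<le> b"
  shows "norm (g (\<gamma> b) - g (\<gamma> a)) \<le> integral {a..b} (\<lambda>t. norm (deriv g (\<gamma> t)))"
proof -
  have cont\<gamma>: "continuous_on {a..b} \<gamma>"
    using \<gamma>(1) has_vector_derivative_continuous continuous_at_imp_continuous_on by blast
  have "continuous_on {a..b} (\<lambda>t. deriv g (\<gamma> t))"
    by (rule continuous_on_compose2[OF holomorphic_on_imp_continuous_on[OF
          holomorphic_deriv[OF g open_strip]] cont\<gamma>]) (use inS in auto)
  then have c: "(\<lambda>t. norm (deriv g (\<gamma> t))) integrable_on {a..b}"
    by (intro integrable_continuous_real continuous_on_norm)
  have "((g \<circ> \<gamma>) has_vector_derivative d * deriv g (\<gamma> t)) (at t within {a..b})" if "t \<in> {a..b}" for t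
    by (rule has_vector_derivative_at_within[OF field_vector_diff_chain_at[OF \<gamma>(1)[OF that]
          holomorphic_derivI[OF g open_strip inS[OF that]]]])
  from fundamental_theorem_of_calculus[OF ab this]
  have hi: "((\<lambda>t. d * deriv g (\<gamma> t)) has_integral (g (\<gamma> b) - g (\<gamma> a))) {a..b}"
    by simp
  show ?thesis
    using integral_norm_bound_integral[OF has_integral_integrable[OF hi] c] \<gamma>(2)
    unfolding integral_unique[OF hi] by (simp add: norm_mult)
qed

lemma horizontal_increment:
  assumes "g holomorphic_on strip" "\<bar>\<phi>\<bar> < pi / 2" "a \<le> b"
  shows "norm (g (Complex b \<phi>) - g (Complex a \<phi>)) \<le> line_variation g \<phi> a b"
  unfolding line_variation_def
  by (rule increment_along_unit_speed[where d=1, OF assms(1)])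
     (use assms in \<open>auto simp: strip_def has_vector_derivative_complex_iff intro!: derivative_eq_intros\<close>)

lemma vertical_increment:
  assumes "g holomorphic_on strip" "\<bar>a\<bar> < pi / 2" "\<bar>b\<bar> < pi / 2" "a \<le> b"
  shows "norm (g (Complex s b) - g (Complex s a)) \<le> integral {a..b} (\<lambda>\<phi>. norm (deriv g (Complex s \<phi>)))"
  by (rule increment_along_unit_speed[where d=\<i>, OF assms(1)])
     (use assms in \<open>auto simp: strip_def has_vector_derivative_complex_iff intro!: derivative_eq_intros\<close>)

lemma continuous_deriv_strip:
  assumes "g holomorphic_on strip" "continuous_on A h" "continuous_on A k" "\<And>x. x \<in> A \<Longrightarrow> \<bar>k x\<bar> < pi / 2"
  shows "continuous_on A (\<lambda>x. norm (deriv g (Complex (h x) (k x))))"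
  by (rule continuous_on_norm, rule continuous_on_compose2[OF holomorphic_on_imp_continuous_on[OF
        holomorphic_deriv[OF assms(1) open_strip]]], rule continuous_on_Complex[OF assms(2,3)])
     (use assms(4) in \<open>auto simp: strip_def\<close>)

lemma line_integrable:
  assumes "g holomorphic_on strip" "\<bar>\<phi>\<bar> < pi / 2"
  shows "(\<lambda>s. norm (deriv g (Complex s \<phi>))) integrable_on {a..b}"
  using assms by (intro integrable_continuous_real continuous_deriv_strip) auto

lemma line_variation_nonneg: "0 \<le> line_variation g \<phi> a b"
  unfolding line_variation_def by (cases "(\<lambda>s. norm (deriv g (Complex s \<phi>))) integrable_on {a..b}")
    (auto simp: integral_nonneg not_integrable_integral)

lemma line_variation_combine:
  assumes "g holomorphic_on strip" "\<bar>\<phi>\<bar> < pi / 2" "a \<le> b" "b \<le> c"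
  shows "line_variation g \<phi> a b + line_variation g \<phi> b c = line_variation g \<phi> a c"
  unfolding line_variation_def
  by (rule Henstock_Kurzweil_Integration.integral_combine[OF assms(3,4) line_integrable[OF assms(1,2)]])

lemma line_variation_mono:
  assumes "g holomorphic_on strip" "\<bar>\<phi>\<bar> < pi / 2" "a' \<le> a" "b \<le> b'"
  shows "line_variation g \<phi> a b \<le> line_variation g \<phi> a' b'"
  unfolding line_variation_def using assms
  by (intro integral_subset_le line_integrable) auto

text \<open>
  The lines are taken in pairs since only the sum over a symmetric pair has the right constant.
\<close>
definition bounded_line_variation :: "(complex \<Rightarrow> complex) \<Rightarrow> real \<Rightarrow> bool" where
  "bounded_line_variation g C \<longleftrightarrow> (\<forall>\<phi> a b. \<bar>\<phi>\<bar> < pi / 2 \<longrightarrow> a \<le> b \<longrightarrow>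
     line_variation g \<phi> a b + line_variation g (- \<phi>) a b \<le> C)"

lemma bounded_line_variation_nonneg:
  assumes "bounded_line_variation g C"
  shows "0 \<le> C"
  using assms[unfolded bounded_line_variation_def, rule_format, of 0 0 1]
    line_variation_nonneg[of g 0 0 1] by simp

text \<open>
  Each pair of lines \<open>\<plusminus>\<phi>\<close> with \<open>0 \<le> \<phi> \<le> h\<close> contributes at most \<open>C\<close>. The bound does not depend on the
  length of the rectangle, so long rectangles contain cross sections along which \<open>g\<close> hardly varies.
\<close>
lemma rectangle_integral_le:
  assumes g: "g holomorphic_on strip" and C: "bounded_line_variation g C"
    and h: "0 \<le> h" "h < pi / 2" and ab: "a \<le> b"
  shows "continuous_on {a..b} (\<lambda>s. integral {-h..h} (\<lambda>\<phi>. norm (deriv g (Complex s \<phi>))))"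
    "integral {a..b} (\<lambda>s. integral {-h..h} (\<lambda>\<phi>. norm (deriv g (Complex s \<phi>)))) \<le> h * C"
proof -
  let ?D = "\<lambda>s \<phi>. norm (deriv g (Complex s \<phi>))"
  have c: "continuous_on (cbox (a, -h) (b, h)) (\<lambda>(s, \<phi>). ?D s \<phi>)"
    unfolding split_beta using h
    by (intro continuous_deriv_strip[OF g] continuous_intros) (auto simp: cbox_Pair_eq)
  have c': "continuous_on (cbox (-h) h \<times> cbox a b) (\<lambda>(\<phi>, s). ?D s \<phi>)"
    unfolding split_beta using h
    by (intro continuous_deriv_strip[OF g] continuous_intros) auto
  show "continuous_on {a..b} (\<lambda>s. integral {-h..h} (?D s))"
    using integral_continuous_on_param[of "{a..b}" "-h" h ?D] c by (simp add: cbox_Pair_eq)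
  define I where "I \<phi> = line_variation g \<phi> a b" for \<phi>
  have cI: "continuous_on {-h..h} I"
    unfolding I_def line_variation_def using integral_continuous_on_param[OF c'] by simp
  have cI': "continuous_on {-h..h} (\<lambda>\<phi>. I (- \<phi>))"
    by (intro continuous_on_compose2[OF cI] continuous_intros) auto
  have "integral {a..b} (\<lambda>s. integral {-h..h} (?D s)) = integral {-h..h} I"
    using integral_swap_continuous[OF c] by (simp add: I_def[abs_def] line_variation_def)
  moreover have "integral {-h..h} (\<lambda>\<phi>. I (- \<phi>)) = integral {-h..h} I"
    using Henstock_Kurzweil_Integration.integral_reflect_real[of h "-h" I] by simp
  moreover have "integral {-h..h} I + integral {-h..h} (\<lambda>\<phi>. I (- \<phi>)) = integral {-h..h} (\<lambda>\<phi>. I \<phi> + I (- \<phi>))"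
    by (intro integral_add[symmetric] integrable_continuous_real cI cI')
  moreover have "\<dots> \<le> integral {-h..h} (\<lambda>\<phi>. C)"
    using C[unfolded bounded_line_variation_def, rule_format, OF _ ab] h
    by (intro integral_le integrable_continuous_real continuous_intros cI cI') (auto simp: I_def)
  ultimately show "integral {a..b} (\<lambda>s. integral {-h..h} (?D s)) \<le> h * C"
    using h by simp
qed

text \<open>
  The length \<open>L\<close> is independent of \<open>h\<close>: as \<open>h\<close> approaches \<open>\<pi> / 2\<close> the cross section may move, but it stays
  in the same window.
\<close>
lemma short_crosscut:
  assumes g: "g holomorphic_on strip" and C: "bounded_line_variation g C"
    and h: "0 \<le> h" "h < pi / 2" and L: "0 < L" "pi / 2 * C < L * \<epsilon>"
  obtains s where "s \<in> {x - L..x}" "\<And>\<phi>. \<bar>\<phi>\<bar> \<le> h \<Longrightarrow> norm (g (Complex s \<phi>) - g (Complex s 0)) \<le> \<epsilon>"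
proof -
  let ?V = "\<lambda>s. integral {-h..h} (\<lambda>\<phi>. norm (deriv g (Complex s \<phi>)))"
  have C0: "0 \<le> C"
    by (rule bounded_line_variation_nonneg[OF C])
  have "\<exists>s\<in>{x - L..x}. ?V s \<le> \<epsilon>"
  proof (rule ccontr)
    assume "\<not> ?thesis"
    then have "integral {x - L..x} (\<lambda>s. \<epsilon>) \<le> integral {x - L..x} ?V"
      using L by (intro integral_le integrable_continuous_real rectangle_integral_le[OF g C h])
        (auto simp: not_le intro: less_imp_le)
    also have "\<dots> \<le> h * C" using L by (intro rectangle_integral_le[OF g C h]) auto
    also have "\<dots> \<le> pi / 2 * C" using h C0 by (intro mult_right_mono) auto
    finally show False using L by simp
  qed
  then obtain s where s: "s \<in> {x - L..x}" "?V s \<le> \<epsilon>" by blast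
  have "norm (g (Complex s \<phi>) - g (Complex s 0)) \<le> \<epsilon>" if "\<bar>\<phi>\<bar> \<le> h" for \<phi>
  proof -
    have i: "(\<lambda>\<phi>. norm (deriv g (Complex s \<phi>))) integrable_on {p..q}"
      if "-h \<le> p" "q \<le> h" for p q
      using that h by (intro integrable_continuous_real continuous_deriv_strip[OF g] continuous_intros) auto
    have le: "integral {p..q} (\<lambda>\<phi>. norm (deriv g (Complex s \<phi>))) \<le> ?V s" if "-h \<le> p" "q \<le> h" for p q
      using that by (intro integral_subset_le i) auto
    show ?thesis
    proof (cases "0 \<le> \<phi>")
      case True
      then show ?thesis
        using vertical_increment[OF g, of 0 \<phi> s] le[of 0 \<phi>] that h s(2) by auto
    next
      case False
      then show ?thesis
        using vertical_increment[OF g, of \<phi> 0 s] le[of \<phi> 0] that h s(2)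
        by (auto simp: norm_minus_commute)
    qed
  qed
  with s(1) that show thesis by blast
qed

text \<open>
  By the maximum principle, \<open>g - c\<close> can only be large inside the rectangle if it is large on one of the
  horizontal sides; there it has to climb from its small value at the corner, which costs variation.
\<close>
lemma bump_costs_variation:
  assumes g: "g holomorphic_on strip" and h: "0 < h" "h < pi / 2" and \<epsilon>: "0 < \<epsilon>"
    and cross: "\<And>s \<phi>. s \<in> {p, q} \<Longrightarrow> \<bar>\<phi>\<bar> \<le> h \<Longrightarrow> norm (g (Complex s \<phi>) - c) \<le> \<epsilon> / 2"
    and w: "p \<le> Re w" "Re w \<le> q" "\<bar>Im w\<bar> \<le> h" "\<epsilon> \<le> norm (g w - c)"
  shows "\<epsilon> / 2 \<le> line_variation g h p q + line_variation g (- h) p q"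
proof (rule ccontr)
  define B where "B = \<epsilon> / 2 + (line_variation g h p q + line_variation g (- h) p q)"
  assume "\<not> ?thesis"
  then have B: "B < \<epsilon>" by (simp add: B_def)
  define Q where "Q = cbox (Complex p (- h)) (Complex q h)"
  have Qs: "Q \<subseteq> strip" using h by (auto simp: Q_def in_cbox_complex_iff strip_def)
  have nn: "0 \<le> line_variation g h p q" "0 \<le> line_variation g (- h) p q"
    by (rule line_variation_nonneg)+
  have "norm (g w - c) \<le> B"
  proof (rule maximum_modulus_frontier[where S = Q and f = "\<lambda>z. g z - c"])
    show "(\<lambda>z. g z - c) holomorphic_on interior Q"
      using Qs interior_subset by (intro holomorphic_intros holomorphic_on_subset[OF g]) blast
    show "continuous_on (closure Q) (\<lambda>z. g z - c)"
      using Qs by (intro continuous_intros holomorphic_on_imp_continuous_on holomorphic_on_subset[OF g])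
        (simp add: Q_def)
    show "bounded Q" by (simp add: Q_def bounded_cbox)
    show "w \<in> Q" using w by (auto simp: Q_def in_cbox_complex_iff)
    fix z assume "z \<in> frontier Q"
    then have z: "Re z \<in> {p..q}" "\<bar>Im z\<bar> \<le> h" "Re z \<in> {p, q} \<or> \<bar>Im z\<bar> = h"
      by (auto simp: Q_def frontier_cbox in_cbox_complex_iff in_box_complex_iff)
    from z(3) show "norm (g z - c) \<le> B"
    proof
      assume "Re z \<in> {p, q}"
      from cross[OF this z(2)] show ?thesis using nn by (simp add: B_def)
    next
      assume i: "\<bar>Im z\<bar> = h"
      then have i2: "\<bar>Im z\<bar> < pi / 2" using h by simp
      have "norm (g (Complex (Re z) (Im z)) - g (Complex p (Im z))) \<le> line_variation g (Im z) p (Re z)"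
        using z by (intro horizontal_increment g i2) auto
      also have "\<dots> \<le> line_variation g (Im z) p q"
        using z by (intro line_variation_mono g i2) auto
      also have "\<dots> \<le> line_variation g h p q + line_variation g (- h) p q"
        using nn i h by (auto simp: abs_if split: if_splits)
      finally have "norm (g z - g (Complex p (Im z))) \<le> line_variation g h p q + line_variation g (- h) p q"
        by simp
      moreover have "norm (g (Complex p (Im z)) - c) \<le> \<epsilon> / 2" using cross z(2) by blast
      ultimately show ?thesis
        using norm_triangle_ineq[of "g z - g (Complex p (Im z))" "g (Complex p (Im z)) - c"]
        by (simp add: B_def)
    qed
  qed
  with B w(4) show False by simp
qed

section \<open>Limits at the end of the strip\<close>

text \<open>
  The variation over \<open>[- n, 0]\<close> increases with \<open>n\<close> and is bounded by \<open>C\<close>, so the oscillation of \<open>g\<close> far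
  to the left on the axis is arbitrarily small.
\<close>
lemma real_axis_limit:
  assumes g: "g holomorphic_on strip" and C: "bounded_line_variation g C"
  obtains c where "\<And>\<epsilon>. 0 < \<epsilon> \<Longrightarrow> \<exists>A. \<forall>s\<le>A. norm (g (Complex s 0) - c) \<le> \<epsilon>"
proof -
  define v where "v n = line_variation g 0 (- real n) 0" for n
  have z: "\<bar>0\<bar> < pi / 2" by simp
  have "v n \<le> C" for n
    using C[unfolded bounded_line_variation_def, rule_format, of 0 "- real n" 0]
      line_variation_nonneg[of g 0 "- real n" 0] by (simp add: v_def)
  then have bdd: "bdd_above (range v)" by (auto simp: bdd_above_def)
  have osc: "\<exists>A. \<forall>s s'. s \<le> s' \<and> s' \<le> A \<longrightarrow> norm (g (Complex s' 0) - g (Complex s 0)) < \<epsilon>"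
    if "0 < \<epsilon>" for \<epsilon> :: real
  proof -
    have "(SUP n. v n) - \<epsilon> < (SUP n. v n)" using that by simp
    then obtain N where N: "(SUP n. v n) - \<epsilon> < v N"
      using less_cSUP_iff[OF _ bdd] by auto
    show ?thesis
    proof (intro exI[of _ "- real N"] allI impI)
      fix s s' assume s: "s \<le> s' \<and> s' \<le> - real N"
      obtain m where m: "- s \<le> real m" using real_arch_simple by blast
      have "norm (g (Complex s' 0) - g (Complex s 0)) \<le> line_variation g 0 s s'"
        using s by (intro horizontal_increment g z) auto
      also have "\<dots> \<le> line_variation g 0 (- real m) (- real N)"
        using s m by (intro line_variation_mono g z) auto
      also have "\<dots> = v m - v N"
        using line_variation_combine[OF g z, of "- real m" "- real N" 0] s m by (simp add: v_def)
      also have "\<dots> \<le> (SUP n. v n) - v N" using cSUP_upper[OF _ bdd, of m] by simp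
      finally show "norm (g (Complex s' 0) - g (Complex s 0)) < \<epsilon>" using N by simp
    qed
  qed
  define X where "X n = g (Complex (- real n) 0)" for n
  have "Cauchy X"
  proof (rule metric_CauchyI)
    fix \<epsilon> :: real assume "0 < \<epsilon>"
    from osc[OF this] obtain A where A: "\<And>s s'. s \<le> s' \<Longrightarrow> s' \<le> A \<Longrightarrow>
      norm (g (Complex s' 0) - g (Complex s 0)) < \<epsilon>" by blast
    obtain M where M: "- A \<le> real M" using real_arch_simple by blast
    have "dist (X m) (X n) < \<epsilon>" if "M \<le> m" "M \<le> n" for m n
    proof (cases "m \<le> n")
      case True
      then show ?thesis using A[of "- real n" "- real m"] that M by (simp add: X_def dist_norm)
    next
      case False
      then show ?thesis using A[of "- real m" "- real n"] that M
        by (simp add: X_def dist_norm norm_minus_commute)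
    qed
    then show "\<exists>M. \<forall>m\<ge>M. \<forall>n\<ge>M. dist (X m) (X n) < \<epsilon>" by blast
  qed
  then obtain c where c: "X \<longlonglongrightarrow> c" using Cauchy_convergent_iff convergent_def by blast
  have "\<exists>A. \<forall>s\<le>A. norm (g (Complex s 0) - c) \<le> \<epsilon>" if \<epsilon>: "0 < \<epsilon>" for \<epsilon> :: real
  proof -
    from osc[OF \<epsilon>] obtain A where A: "\<And>s s'. s \<le> s' \<Longrightarrow> s' \<le> A \<Longrightarrow>
      norm (g (Complex s' 0) - g (Complex s 0)) < \<epsilon>" by blast
    have "norm (g (Complex s 0) - c) \<le> \<epsilon>" if "s \<le> A" for s
    proof (rule tendsto_upperbound)
      show "(\<lambda>n. norm (g (Complex s 0) - X n)) \<longlonglongrightarrow> norm (g (Complex s 0) - c)"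
        by (intro tendsto_intros c)
      obtain M where M: "- s \<le> real M" using real_arch_simple by blast
      have "norm (g (Complex s 0) - X n) \<le> \<epsilon>" if "M \<le> n" for n
        using A[of "- real n" s] M that \<open>s \<le> A\<close> by (simp add: X_def)
      then show "eventually (\<lambda>n. norm (g (Complex s 0) - X n) \<le> \<epsilon>) sequentially"
        by (auto simp: eventually_sequentially)
    qed auto
    then show ?thesis by blast
  qed
  then show thesis by (rule that)
qed

text \<open>
  The limit along the real axis is also the limit in the whole strip. Otherwise there are points
  arbitrarily far to the left where \<open>g\<close> differs from it by \<open>\<epsilon>\<close>. Cross sections between these points
  separate them into disjoint rectangles, and each of them forces a variation of \<open>\<epsilon> / 2\<close> on the two lines
  at height \<open>\<plusminus>h\<close>, as soon as \<open>h\<close> exceeds the heights of the finitely many points used. Enough points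
  contradict the bound on the total variation.
\<close>
lemma strip_end_limit:
  assumes g: "g holomorphic_on strip" and C: "bounded_line_variation g C"
  obtains c where "\<And>\<epsilon>. 0 < \<epsilon> \<Longrightarrow> \<exists>A. \<forall>w\<in>strip. Re w < A \<longrightarrow> norm (g w - c) < \<epsilon>"
proof -
  obtain c where c: "\<And>\<epsilon>. 0 < \<epsilon> \<Longrightarrow> \<exists>A. \<forall>s\<le>A. norm (g (Complex s 0) - c) \<le> \<epsilon>"
    using real_axis_limit[OF g C] by blast
  have "\<exists>A. \<forall>w\<in>strip. Re w < A \<longrightarrow> norm (g w - c) < \<epsilon>" if \<epsilon>: "0 < \<epsilon>" for \<epsilon>
  proof (rule ccontr)
    assume "\<not> ?thesis"
    then have bump: "\<exists>w\<in>strip. Re w < A \<and> \<epsilon> \<le> norm (g w - c)" for A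
      by (auto simp: not_less)
    from c[of "\<epsilon> / 4"] \<epsilon> obtain A0 where A0: "\<And>s. s \<le> A0 \<Longrightarrow> norm (g (Complex s 0) - c) \<le> \<epsilon> / 4"
      by auto
    obtain L where L: "0 < L" "pi / 2 * C < L * (\<epsilon> / 4)"
    proof
      show "0 < (pi / 2 * \<bar>C\<bar> + 1) / (\<epsilon> / 4)" using \<epsilon> by (intro divide_pos_pos add_nonneg_pos) auto
      have cancel: "x = x / (\<epsilon> / 4) * (\<epsilon> / 4)" for x using \<epsilon> by simp
      have "pi / 2 * C \<le> pi / 2 * \<bar>C\<bar>" by (rule mult_left_mono) auto
      also have "\<dots> < pi / 2 * \<bar>C\<bar> + 1" by (rule less_add_one)
      also have "\<dots> = (pi / 2 * \<bar>C\<bar> + 1) / (\<epsilon> / 4) * (\<epsilon> / 4)"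
        by (rule cancel)
      finally show "pi / 2 * C < (pi / 2 * \<bar>C\<bar> + 1) / (\<epsilon> / 4) * (\<epsilon> / 4)" .
    qed
    have crosscut: "\<exists>s\<in>{x - L..x}. \<forall>\<phi>. \<bar>\<phi>\<bar> \<le> h \<longrightarrow> norm (g (Complex s \<phi>) - c) \<le> \<epsilon> / 2"
      if "0 < h" "h < pi / 2" "x \<le> A0" for h x
    proof -
      obtain s where s: "s \<in> {x - L..x}"
        "\<And>\<phi>. \<bar>\<phi>\<bar> \<le> h \<Longrightarrow> norm (g (Complex s \<phi>) - g (Complex s 0)) \<le> \<epsilon> / 4"
        using short_crosscut[OF g C _ \<open>h < pi / 2\<close> L] \<open>0 < h\<close> by (metis less_imp_le)
      have "norm (g (Complex s \<phi>) - c) \<le> \<epsilon> / 2" if "\<bar>\<phi>\<bar> \<le> h" for \<phi>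
        using norm_triangle_ineq[of "g (Complex s \<phi>) - g (Complex s 0)" "g (Complex s 0) - c"]
          s(2)[OF that] A0[of s] s(1) \<open>x \<le> A0\<close> by auto
      with s(1) show ?thesis by blast
    qed
    \<comment> \<open>\<open>N\<close> bumps to the left of \<open>A0\<close> give variation \<open>N * (\<epsilon> / 2)\<close> on every pair of lines close to the edges.\<close>
    have "\<exists>X\<le>A0. \<exists>h0. 0 < h0 \<and> h0 < pi / 2 \<and> (\<forall>h. h0 \<le> h \<and> h < pi / 2 \<longrightarrow>
        real N * (\<epsilon> / 2) \<le> line_variation g h X A0 + line_variation g (- h) X A0)" for N
    proof (induction N)
      case 0
      show ?case
        by (rule exI[of _ A0], rule conjI[OF order_refl], rule exI[of _ "pi / 4"])
           (auto simp: line_variation_nonneg add_nonneg_nonneg)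
    next
      case (Suc N)
      then obtain X h0 where X: "X \<le> A0" "0 < h0" "h0 < pi / 2"
        and v: "\<And>h. h0 \<le> h \<Longrightarrow> h < pi / 2 \<Longrightarrow>
          real N * (\<epsilon> / 2) \<le> line_variation g h X A0 + line_variation g (- h) X A0" by blast
      obtain w where w: "w \<in> strip" "Re w < X - L" "\<epsilon> \<le> norm (g w - c)" using bump by blast
      define h1 where "h1 = max h0 \<bar>Im w\<bar>"
      have h1: "Re w - L \<le> A0" "0 < h1" "h1 < pi / 2"
        using w X L by (auto simp: h1_def strip_def)
      have "\<forall>h. h1 \<le> h \<and> h < pi / 2 \<longrightarrow> real (Suc N) * (\<epsilon> / 2) \<le>
          line_variation g h (Re w - L) A0 + line_variation g (- h) (Re w - L) A0"
      proof (intro allI impI)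
        fix h assume "h1 \<le> h \<and> h < pi / 2"
        then have h: "h0 \<le> h" "\<bar>Im w\<bar> \<le> h" "0 < h" "h < pi / 2" using X by (auto simp: h1_def)
        obtain q where q: "q \<in> {X - L..X}" "\<And>\<phi>. \<bar>\<phi>\<bar> \<le> h \<Longrightarrow> norm (g (Complex q \<phi>) - c) \<le> \<epsilon> / 2"
          using crosscut[OF h(3,4) X(1)] by blast
        obtain p where p: "p \<in> {Re w - L..Re w}" "\<And>\<phi>. \<bar>\<phi>\<bar> \<le> h \<Longrightarrow> norm (g (Complex p \<phi>) - c) \<le> \<epsilon> / 2"
          using crosscut[OF h(3,4), of "Re w"] w(2) X(1) L(1) by auto
        have "\<epsilon> / 2 \<le> line_variation g h p q + line_variation g (- h) p q"
          using p q w h by (intro bump_costs_variation[OF g h(3,4) \<epsilon>, of p q c w]) auto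
        moreover have "line_variation g \<psi> p q + line_variation g \<psi> X A0 \<le> line_variation g \<psi> (Re w - L) A0"
          if "\<bar>\<psi>\<bar> < pi / 2" for \<psi>
        proof -
          have "line_variation g \<psi> p q \<le> line_variation g \<psi> (Re w - L) X"
            using p q by (intro line_variation_mono[OF g that]) auto
          then show ?thesis
            using line_variation_combine[OF g that, of "Re w - L" X A0] w(2) L X by simp
        qed
        from this[of h] this[of "- h"]
        have "line_variation g h p q + line_variation g h X A0 \<le> line_variation g h (Re w - L) A0"
          "line_variation g (- h) p q + line_variation g (- h) X A0 \<le> line_variation g (- h) (Re w - L) A0"
          using h by auto
        ultimately show "real (Suc N) * (\<epsilon> / 2) \<le>
            line_variation g h (Re w - L) A0 + line_variation g (- h) (Re w - L) A0"
          using v[OF h(1,4)] by (simp add: algebra_simps)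
      qed
      with h1 show ?case by blast
    qed
    moreover obtain N where "C < real N * (\<epsilon> / 2)"
      using reals_Archimedean3[of "\<epsilon> / 2"] \<epsilon> by auto
    moreover have "line_variation g h X A0 + line_variation g (- h) X A0 \<le> C"
      if "0 < h" "h < pi / 2" "X \<le> A0" for h X
      using C that by (auto simp: bounded_line_variation_def)
    ultimately show False by (meson not_less order_refl order_trans)
  qed
  then show thesis by (rule that)
qed

section \<open>Integrals over the circle and Hardy means\<close>

lemma circle_measure_nn_integral:
  assumes "\<Phi> \<in> borel_measurable (restrict_space borel (sphere 0 1))"
  shows "(\<integral>\<^sup>+ \<zeta>. \<Phi> \<zeta> \<partial>circle_measure)
     = (\<integral>\<^sup>+ t. \<Phi> (cis t) * indicator {0..2 * pi} t \<partial>lborel) / ennreal (2 * pi)"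
proof -
  have "cis \<in> measurable borel (restrict_space borel (sphere 0 1))"
    by (rule measurable_restrict_space2)
       (auto intro!: borel_measurable_continuous_onI continuous_intros)
  then have m: "(\<lambda>t. \<Phi> (cis t)) \<in> borel_measurable lborel"
    using measurable_compose[OF _ assms] by simp
  show ?thesis
    unfolding circle_measure_def
    by (subst nn_integral_distr[OF cis_measurable_circle], simp add: assms, subst nn_integral_uniform_measure[OF m]) auto
qed

lemma circle_integral_eq_hardy_mean:
  assumes F: "F holomorphic_on ball 0 1" and r: "0 \<le> r" "r < 1"
  shows "integral {0..2 * pi} (\<lambda>t. norm (F (of_real r * cis t))) = 2 * pi * hardy_mean 1 F r"
proof -
  define N where "N \<zeta> = norm (F (of_real r * \<zeta>))" for \<zeta>
  have cN: "continuous_on (sphere 0 1) N"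
    unfolding N_def using r
    by (intro continuous_intros continuous_on_compose2[OF holomorphic_on_imp_continuous_on[OF F]])
       (auto simp: norm_mult)
  then have mN: "N \<in> borel_measurable (restrict_space borel (sphere 0 1))"
    by (rule borel_measurable_continuous_on_restrict)
  define I where "I = integral {0..2 * pi} (\<lambda>t. N (cis t))"
  have "continuous_on {0..2 * pi} (\<lambda>t. N (cis t))"
    by (intro continuous_on_compose2[OF cN] continuous_intros) auto
  then have hi: "((\<lambda>t. N (cis t)) has_integral I) {0..2 * pi}"
    unfolding I_def by (intro integrable_integral integrable_continuous_real)
  have I0: "0 \<le> I" using hi by (rule has_integral_nonneg) (simp add: N_def)
  have "(\<integral>\<^sup>+ \<zeta>. ennreal (N \<zeta>) \<partial>circle_measure) = ennreal I / ennreal (2 * pi)"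
    by (subst circle_measure_nn_integral)
       (use mN nn_integral_has_integral_lebesgue'[OF _ hi] in \<open>simp_all add: N_def[abs_def]\<close>)
  also have "\<dots> = ennreal (I / (2 * pi))" using I0 by (simp add: divide_ennreal)
  finally have nn: "(\<integral>\<^sup>+ \<zeta>. ennreal (N \<zeta>) \<partial>circle_measure) = ennreal (I / (2 * pi))" .
  have "(LINT \<zeta>|circle_measure. N \<zeta>) = I / (2 * pi)"
    using mN nn I0
    by (subst integral_eq_nn_integral) (auto simp: N_def circle_measure_def)
  then have "hardy_mean 1 F r = I / (2 * pi)"
    unfolding hardy_mean_def N_def[symmetric] using I0 by (simp add: N_def)
  then show ?thesis by (simp add: I_def N_def)
qed

lemma circle_integral_le_hardy_norm:
  assumes "F \<in> hardy_space 1" "0 \<le> r" "r < 1"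
  shows "integral {0..2 * pi} (\<lambda>t. norm (F (of_real r * cis t))) \<le> 2 * pi * hardy_norm 1 F"
proof -
  have "hardy_mean 1 F r \<le> hardy_norm 1 F"
    unfolding hardy_norm_def using assms by (intro cSUP_upper) (auto simp: hardy_space_def)
  then show ?thesis
    using circle_integral_eq_hardy_mean[of F r] assms by (auto simp: hardy_space_def)
qed

section \<open>Boundary values of functions with derivative in the Hardy space\<close>

definition to_strip :: "(complex \<Rightarrow> complex) \<Rightarrow> complex \<Rightarrow> complex \<Rightarrow> complex" where
  "to_strip f \<eta> w = f (\<eta> * disc_of_strip w)"

lemma to_strip_derivative:
  assumes f: "f holomorphic_on ball 0 1" and \<eta>: "norm \<eta> = 1" and w: "w \<in> strip"
  shows "(to_strip f \<eta> has_field_derivative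
    deriv f (\<eta> * disc_of_strip w) * (\<eta> * (- (1 - (disc_of_strip w)\<^sup>2) / 2))) (at w)"
proof -
  have b: "\<eta> * disc_of_strip w \<in> ball 0 1"
    using disc_of_strip_in_ball[OF w] \<eta> by (simp add: norm_mult)
  show ?thesis
    unfolding to_strip_def
    by (rule DERIV_chain2[where f = f, OF holomorphic_derivI[OF f open_ball b]
        DERIV_cmult[OF has_field_derivative_disc_of_strip[OF w]]])
qed

lemma to_strip_holomorphic:
  assumes "f holomorphic_on ball 0 1" "norm \<eta> = 1"
  shows "to_strip f \<eta> holomorphic_on strip"
  using to_strip_derivative[OF assms] holomorphic_on_open[OF open_strip] by blast

lemma norm_deriv_to_strip:
  assumes "f holomorphic_on ball 0 1" "norm \<eta> = 1" "w \<in> strip"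
  shows "norm (deriv (to_strip f \<eta>) w)
     = norm (deriv f (\<eta> * disc_of_strip w)) * (norm (1 - (disc_of_strip w)\<^sup>2) / 2)"
  by (simp only: DERIV_imp_deriv[OF to_strip_derivative[OF assms]] norm_mult norm_divide
      norm_minus_cancel assms(2) norm_numeral mult_1)

lemma bounded_line_variation_to_strip:
  assumes f: "f holomorphic_on ball 0 1" and F: "deriv f \<in> hardy_space 1" and \<eta>: "norm \<eta> = 1"
  shows "bounded_line_variation (to_strip f \<eta>) (2 * pi * hardy_norm 1 (deriv f))"
  unfolding bounded_line_variation_def line_variation_def
proof (intro allI impI)
  fix \<phi> a b :: real assume \<phi>: "\<bar>\<phi>\<bar> < pi / 2" and ab: "a \<le> b"
  have "deriv f holomorphic_on ball 0 1" by (rule holomorphic_deriv[OF f open_ball])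
  from line_integrals[OF this \<eta> circle_integral_le_hardy_norm[OF F] \<phi> ab]
  show "integral {a..b} (\<lambda>s. norm (deriv (to_strip f \<eta>) (Complex s \<phi>)))
      + integral {a..b} (\<lambda>s. norm (deriv (to_strip f \<eta>) (Complex s (- \<phi>)))) \<le> 2 * pi * hardy_norm 1 (deriv f)"
    using \<phi> by (simp add: norm_deriv_to_strip[OF f \<eta>] Complex_in_strip)
qed

text \<open>
  The real part of the preimage is what tells when points of the disc approach the left end of the strip.
\<close>
lemma strip_preimage:
  assumes x: "norm x < 1"
  obtains w where "w \<in> strip" "disc_of_strip w = x" "Re w = ln (norm ((1 - x) / (1 + x)))"
proof -
  define u where "u = (1 - x) / (1 + x)"
  have nx: "1 + x \<noteq> 0" "1 - x \<noteq> 0" using x by (auto simp: add_eq_0_iff)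
  have "u = ((1 - x) * cnj (1 + x)) / of_real ((norm (1 + x))\<^sup>2)"
    unfolding u_def by (subst complex_div_cnj) simp
  then have "Re u = Re ((1 - x) * cnj (1 + x)) / (norm (1 + x))\<^sup>2" by (simp only: Re_divide_of_real)
  also have "Re ((1 - x) * cnj (1 + x)) = 1 - (norm x)\<^sup>2"
    unfolding cmod_power2 by (simp add: power2_eq_square algebra_simps)
  finally have Re: "0 < Re u"
    using x nx by (simp add: abs_square_less_1)
  have u0: "u \<noteq> 0" using nx by (simp add: u_def)
  show thesis
  proof
    show "Ln u \<in> strip" using Re_Ln_pos_lt[OF u0] Re by (simp add: strip_def)
    have "1 + u = 2 / (1 + x)" "1 - u = 2 * x / (1 + x)"
      using nx by (simp_all add: u_def field_simps)
    then show "disc_of_strip (Ln u) = x"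
      using nx u0 by (simp add: disc_of_strip_def)
    show "Re (Ln u) = ln (norm ((1 - x) / (1 + x)))" using u0 by (simp add: u_def)
  qed
qed

text \<open>
  In strip coordinates centred at \<open>\<eta>\<close>, small neighbourhoods of \<open>\<eta>\<close> in the disc lie far to the left,
  so the limit at the end of the strip is an unrestricted limit in the disc.
\<close>
lemma tendsto_boundary_value:
  assumes f: "f holomorphic_on ball 0 1" and F: "deriv f \<in> hardy_space 1" and \<eta>: "norm \<eta> = 1"
  shows "(f \<longlongrightarrow> boundary_value f \<eta>) (at \<eta> within ball 0 1)"
proof -
  have \<eta>0: "\<eta> \<noteq> 0" using \<eta> by auto
  obtain c where c: "\<And>\<epsilon>. 0 < \<epsilon> \<Longrightarrow> \<exists>A. \<forall>w\<in>strip. Re w < A \<longrightarrow> norm (to_strip f \<eta> w - c) < \<epsilon>"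
    using strip_end_limit[OF to_strip_holomorphic[OF f \<eta>] bounded_line_variation_to_strip[OF f F \<eta>]]
    by blast
  have "(f \<longlongrightarrow> c) (at \<eta> within ball 0 1)"
    unfolding Lim_within
  proof (intro allI impI)
    fix \<epsilon> :: real assume "0 < \<epsilon>"
    from c[OF this] obtain A where A: "\<And>w. w \<in> strip \<Longrightarrow> Re w < A \<Longrightarrow> norm (to_strip f \<eta> w - c) < \<epsilon>"
      by blast
    have "dist (f z) c < \<epsilon>" if z: "z \<in> ball 0 1" "dist z \<eta> < min 1 (exp A)" for z
    proof -
      define x where "x = z / \<eta>"
      have x: "norm x < 1" using z \<eta> by (simp add: x_def norm_divide)
      have zx: "z = \<eta> * x" using \<eta>0 by (simp add: x_def)
      have "z - \<eta> = \<eta> * (x - 1)" by (simp add: zx algebra_simps)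
      then have d: "norm (1 - x) < min 1 (exp A)"
        using z(2) \<eta> by (simp add: dist_norm norm_mult norm_minus_commute)
      have "2 - norm (1 - x) \<le> norm (1 + x)"
        using norm_triangle_ineq[of "1 + x" "1 - x"] by simp
      then have "norm (1 - x) / norm (1 + x) \<le> norm (1 - x) / 1"
        using d by (intro divide_left_mono) auto
      then have lt: "norm ((1 - x) / (1 + x)) < exp A" using d by (simp add: norm_divide)
      have pos: "0 < norm ((1 - x) / (1 + x))" using x by (auto simp: add_eq_0_iff)
      obtain w where w: "w \<in> strip" "disc_of_strip w = x" "Re w = ln (norm ((1 - x) / (1 + x)))"
        using strip_preimage[OF x] by blast
      have "Re w < A" unfolding w(3) using lt pos by (metis ln_exp ln_less_cancel_iff exp_gt_zero)
      from A[OF w(1) this] show ?thesis by (simp add: to_strip_def w(2) zx dist_norm)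
    qed
    then show "\<exists>d>0. \<forall>x\<in>ball 0 1. 0 < dist x \<eta> \<and> dist x \<eta> < d \<longrightarrow> dist (f x) c < \<epsilon>"
      by (intro exI[of _ "min 1 (exp A)"]) auto
  qed
  moreover have "at \<eta> within ball 0 1 \<noteq> bot"
    using \<eta> by (simp add: trivial_limit_within islimpt_ball)
  ultimately have "boundary_value f \<eta> = c"
    unfolding boundary_value_def by (intro tendsto_Lim)
  with \<open>(f \<longlongrightarrow> c) _\<close> show ?thesis by simp
qed

lemma boundary_value_sequentially:
  assumes "f holomorphic_on ball 0 1" "deriv f \<in> hardy_space 1" "norm \<eta> = 1"
    and X: "X \<longlonglongrightarrow> \<eta>" "\<And>n. norm (X n) < 1"
  shows "(\<lambda>n. f (X n)) \<longlonglongrightarrow> boundary_value f \<eta>"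
proof (rule filterlim_compose[OF tendsto_boundary_value[OF assms(1-3)]])
  have "X n \<noteq> \<eta>" for n using X(2)[of n] assms(3) by auto
  then show "filterlim X (at \<eta> within ball 0 1) sequentially"
    unfolding filterlim_at using X by auto
qed

section \<open>Differences across the strip\<close>

text \<open>
  The difference of the values at heights \<open>\<plusminus>h\<close> is at most the integral of \<open>|g'|\<close> over the cross section,
  and integrating over \<open>s\<close> gives an area integral.
\<close>
lemma strip_difference_integral:
  assumes g: "g holomorphic_on strip" and C: "bounded_line_variation g C"
    and h: "0 \<le> h" "h < pi / 2" and ab: "a \<le> b"
  shows "integral {a..b} (\<lambda>s. norm (g (Complex s h) - g (Complex s (- h)))) \<le> pi / 2 * C"
proof -
  have "continuous_on {a..b} (\<lambda>s. norm (g (Complex s h) - g (Complex s (- h))))"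
    using h by (intro continuous_intros continuous_on_compose2[OF holomorphic_on_imp_continuous_on[OF g]])
      (auto intro!: continuous_intros simp: strip_def)
  then have "integral {a..b} (\<lambda>s. norm (g (Complex s h) - g (Complex s (- h))))
    \<le> integral {a..b} (\<lambda>s. integral {-h..h} (\<lambda>\<phi>. norm (deriv g (Complex s \<phi>))))"
    using h by (intro integral_le integrable_continuous_real rectangle_integral_le(1)[OF g C h ab]
        vertical_increment[OF g]) auto
  also have "\<dots> \<le> h * C" by (rule rectangle_integral_le(2)[OF g C h ab])
  also have "\<dots> \<le> pi / 2 * C"
    using h bounded_line_variation_nonneg[OF C] by (intro mult_right_mono) auto
  finally show ?thesis .
qed

text \<open>
  The strip coordinate of \<open>cis \<theta>\<close> on the lower edge, and of \<open>cis (- \<theta>)\<close> on the upper edge, has this real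
  part.
\<close>
definition log_tan_half :: "real \<Rightarrow> real" where "log_tan_half \<theta> = ln (tan (\<theta> / 2))"

lemma half_angle_pos:
  assumes "0 < \<theta>" "\<theta> < pi"
  shows "0 < sin (\<theta> / 2)" "0 < cos (\<theta> / 2)" "0 < tan (\<theta> / 2)" "0 < sin \<theta>"
  using assms by (auto intro!: sin_gt_zero cos_gt_zero tan_gt_zero)

lemma log_tan_half_derivative:
  assumes "0 < \<theta>" "\<theta> < pi"
  shows "(log_tan_half has_real_derivative 1 / sin \<theta>) (at \<theta>)"
proof -
  note p = half_angle_pos[OF assms]
  have "(log_tan_half has_real_derivative (1 / tan (\<theta> / 2)) * ((inverse ((cos (\<theta> / 2))\<^sup>2)) * (1 / 2))) (at \<theta>)"
    unfolding log_tan_half_def using p by (auto intro!: derivative_eq_intros)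
  moreover have "(1 / tan (\<theta> / 2)) * ((inverse ((cos (\<theta> / 2))\<^sup>2)) * (1 / 2)) = 1 / sin \<theta>"
    using p sin_double[of "\<theta> / 2"] by (simp add: tan_def field_simps power2_eq_square)
  ultimately show ?thesis by simp
qed

lemma log_tan_half_mono:
  assumes "0 < a" "a \<le> b" "b < pi"
  shows "log_tan_half a \<le> log_tan_half b"
proof -
  have "tan (a / 2) \<le> tan (b / 2)" using assms by (intro tan_mono_le) auto
  then show ?thesis
    unfolding log_tan_half_def using half_angle_pos[of a] half_angle_pos[of b] assms by simp
qed

lemma disc_of_strip_edges:
  assumes "0 < \<theta>" "\<theta> < pi"
  shows "exp (Complex (log_tan_half \<theta>) (pi / 2)) = \<i> * tan (\<theta> / 2)"
    "exp (Complex (log_tan_half \<theta>) (- (pi / 2))) = - (\<i> * tan (\<theta> / 2))"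
    "disc_of_strip (Complex (log_tan_half \<theta>) (pi / 2)) = cis (- \<theta>)"
    "disc_of_strip (Complex (log_tan_half \<theta>) (- (pi / 2))) = cis \<theta>"
proof -
  note p = half_angle_pos[OF assms]
  show e: "exp (Complex (log_tan_half \<theta>) (pi / 2)) = \<i> * tan (\<theta> / 2)"
    "exp (Complex (log_tan_half \<theta>) (- (pi / 2))) = - (\<i> * tan (\<theta> / 2))"
    using p by (auto simp: complex_eq_iff Re_exp Im_exp log_tan_half_def)
  have c0: "complex_of_real (cos (\<theta> / 2)) \<noteq> 0" using p by simp
  have t: "complex_of_real (tan (\<theta> / 2)) = of_real (sin (\<theta> / 2)) / of_real (cos (\<theta> / 2))"
    by (simp add: tan_def)
  have c1: "cos (\<theta> / 2) * (1 + \<i> * tan (\<theta> / 2)) = cis (\<theta> / 2)"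
    unfolding t using c0 by (simp add: complex_eq_iff)
  have c2: "cos (\<theta> / 2) * (1 - \<i> * tan (\<theta> / 2)) = cis (- \<theta> / 2)"
    unfolding t using c0 by (simp add: complex_eq_iff)
  have "(1 - \<i> * tan (\<theta> / 2)) / (1 + \<i> * tan (\<theta> / 2)) = cis (- \<theta> / 2) / cis (\<theta> / 2)"
    unfolding c1[symmetric] c2[symmetric] using c0 by simp
  then show "disc_of_strip (Complex (log_tan_half \<theta>) (pi / 2)) = cis (- \<theta>)"
    unfolding disc_of_strip_def e by (simp add: cis_divide)
  have "(1 + \<i> * tan (\<theta> / 2)) / (1 - \<i> * tan (\<theta> / 2)) = cis (\<theta> / 2) / cis (- \<theta> / 2)"
    unfolding c1[symmetric] c2[symmetric] using c0 by simp
  then show "disc_of_strip (Complex (log_tan_half \<theta>) (- (pi / 2))) = cis \<theta>"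
    unfolding disc_of_strip_def e by (simp add: cis_divide)
qed

lemma disc_of_strip_tendsto_edges:
  assumes \<theta>: "0 < \<theta>" "\<theta> < pi" and h: "h \<longlonglongrightarrow> pi / 2"
  shows "(\<lambda>n. disc_of_strip (Complex (log_tan_half \<theta>) (h n))) \<longlonglongrightarrow> cis (- \<theta>)"
    "(\<lambda>n. disc_of_strip (Complex (log_tan_half \<theta>) (- h n))) \<longlonglongrightarrow> cis \<theta>"
proof -
  have n: "1 + exp (Complex (log_tan_half \<theta>) (pi / 2)) \<noteq> 0"
    "1 + exp (Complex (log_tan_half \<theta>) (- (pi / 2))) \<noteq> 0"
    unfolding disc_of_strip_edges[OF \<theta>] by (auto simp: complex_eq_iff)
  show "(\<lambda>n. disc_of_strip (Complex (log_tan_half \<theta>) (h n))) \<longlonglongrightarrow> cis (- \<theta>)"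
    unfolding disc_of_strip_edges(3)[OF \<theta>, symmetric] unfolding disc_of_strip_def
    by (intro tendsto_intros h n)
  show "(\<lambda>n. disc_of_strip (Complex (log_tan_half \<theta>) (- h n))) \<longlonglongrightarrow> cis \<theta>"
    unfolding disc_of_strip_edges(4)[OF \<theta>, symmetric] unfolding disc_of_strip_def
    by (intro tendsto_intros h n)
qed

text \<open>
  Substituting \<open>s = log_tan_half \<theta>\<close> turns \<open>ds\<close> into \<open>d\<theta> / sin \<theta>\<close>, and \<open>sin \<theta> \<le> |1 - cis \<theta>|\<close>.
\<close>
lemma arc_difference_integral:
  assumes g: "g holomorphic_on strip" and C: "bounded_line_variation g C"
    and h: "0 \<le> h" "h < pi / 2" and ab: "0 < a" "a \<le> b" "b < pi"
  defines "q \<equiv> \<lambda>\<theta>. norm (g (Complex (log_tan_half \<theta>) h) - g (Complex (log_tan_half \<theta>) (- h))) / norm (1 - cis \<theta>)"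
  shows "continuous_on {a..b} q" "integral {a..b} q \<le> pi / 2 * C"
proof -
  let ?D = "\<lambda>s. norm (g (Complex s h) - g (Complex s (- h)))"
  have contg: "continuous_on strip g" by (rule holomorphic_on_imp_continuous_on[OF g])
  have cD: "continuous_on A ?D" for A
    using h by (intro continuous_intros continuous_on_compose2[OF contg])
      (auto intro!: continuous_intros simp: strip_def)
  have sp: "0 < sin \<theta>" if "\<theta> \<in> {a..b}" for \<theta> using that ab by (intro sin_gt_zero) auto
  have le: "sin \<theta> \<le> norm (1 - cis \<theta>)" for \<theta>
    using abs_Im_le_cmod[of "1 - cis \<theta>"] by simp
  have np: "0 < norm (1 - cis \<theta>)" if "\<theta> \<in> {a..b}" for \<theta> using sp[OF that] le[of \<theta>] by linarith
  have d: "(log_tan_half has_real_derivative 1 / sin \<theta>) (at \<theta>)" if "\<theta> \<in> {a..b}" for \<theta>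
    using that ab by (intro log_tan_half_derivative) auto
  then have cl: "continuous_on {a..b} log_tan_half"
    by (meson DERIV_isCont continuous_at_imp_continuous_on)
  have cD': "continuous_on {a..b} (\<lambda>\<theta>. ?D (log_tan_half \<theta>))"
    by (rule continuous_on_compose2[OF cD[of UNIV] cl]) auto
  show cq: "continuous_on {a..b} q"
    unfolding q_def using np by (intro continuous_on_divide cD' continuous_intros) auto
  have hi: "((\<lambda>\<theta>. (1 / sin \<theta>) *\<^sub>R ?D (log_tan_half \<theta>)) has_integral
     integral {log_tan_half a..log_tan_half b} ?D) {a..b}"
  proof (rule has_integral_substitution)
    show "log_tan_half ` {a..b} \<subseteq> {log_tan_half a..log_tan_half b}"
      using ab log_tan_half_mono by auto
    show "log_tan_half a \<le> log_tan_half b" using ab by (rule log_tan_half_mono)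
  qed (use ab cD d in \<open>simp_all add: has_field_derivative_at_within\<close>)
  have "integral {a..b} q \<le> integral {a..b} (\<lambda>\<theta>. (1 / sin \<theta>) *\<^sub>R ?D (log_tan_half \<theta>))"
  proof (intro integral_le integrable_continuous_real[OF cq] has_integral_integrable[OF hi])
    fix \<theta> assume \<theta>: "\<theta> \<in> {a..b}"
    have "q \<theta> \<le> ?D (log_tan_half \<theta>) / sin \<theta>"
      unfolding q_def using sp[OF \<theta>] le by (intro divide_left_mono mult_pos_pos np[OF \<theta>]) auto
    then show "q \<theta> \<le> (1 / sin \<theta>) *\<^sub>R ?D (log_tan_half \<theta>)" by simp
  qed
  also have "\<dots> = integral {log_tan_half a..log_tan_half b} ?D" by (rule integral_unique[OF hi])
  also have "\<dots> \<le> pi / 2 * C"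
    using ab by (intro strip_difference_integral[OF g C h] log_tan_half_mono)
  finally show "integral {a..b} q \<le> pi / 2 * C" .
qed

section \<open>Passage to the boundary\<close>

text \<open>
  Fatou's lemma with a single parameter \<open>\<delta>\<close> tending to 0, which is both the distance of the horizontal
  lines from the edges of the strip and the length cut off at the two ends of \<open>(0, \<pi>)\<close>. The existence
  of all boundary values gives pointwise convergence of the integrands.
\<close>
lemma half_circle_bound:
  assumes f: "f holomorphic_on ball 0 1" and F: "deriv f \<in> hardy_space 1" and \<eta>: "norm \<eta> = 1"
  shows "(\<integral>\<^sup>+ \<theta>. ennreal (norm (boundary_value f (cis \<theta> * \<eta>) - boundary_value f (cis (- \<theta>) * \<eta>))
      / norm (1 - cis \<theta>)) * indicator {0<..<pi} \<theta> \<partial>lborel) \<le> ennreal (pi\<^sup>2 * hardy_norm 1 (deriv f))"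
    (is "(\<integral>\<^sup>+ \<theta>. ?P \<theta> * _ \<partial>lborel) \<le> _")
proof -
  define g where "g = to_strip f \<eta>"
  define C where "C = 2 * pi * hardy_norm 1 (deriv f)"
  have g: "g holomorphic_on strip" unfolding g_def by (rule to_strip_holomorphic[OF f \<eta>])
  have C: "bounded_line_variation g C"
    unfolding g_def C_def by (rule bounded_line_variation_to_strip[OF f F \<eta>])
  define \<delta> where "\<delta> n = 1 / real (Suc n)" for n
  define h where "h n = pi / 2 - \<delta> n" for n
  have \<delta>: "0 < \<delta> n" "\<delta> n \<le> 1" for n by (auto simp: \<delta>_def)
  have h: "0 \<le> h n" "h n < pi / 2" for n using \<delta>[of n] pi_gt3 by (auto simp: h_def)
  have ab: "0 < \<delta> n" "\<delta> n \<le> pi - \<delta> n" "pi - \<delta> n < pi" for n using \<delta>[of n] pi_gt3 by auto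
  have \<delta>lim: "\<delta> \<longlonglongrightarrow> 0" unfolding \<delta>_def by (rule lim_inverse_n'[THEN LIMSEQ_Suc])
  have hlim: "h \<longlonglongrightarrow> pi / 2" unfolding h_def using tendsto_diff[OF tendsto_const \<delta>lim] by simp
  define q where "q n \<theta> = norm (g (Complex (log_tan_half \<theta>) (h n)) - g (Complex (log_tan_half \<theta>) (- h n)))
      / norm (1 - cis \<theta>)" for n \<theta>
  define R where "R n \<theta> = ennreal (q n \<theta>) * indicator {\<delta> n..pi - \<delta> n} \<theta>" for n \<theta>
  note arc = arc_difference_integral[OF g C h ab, folded q_def]
  have int: "(\<integral>\<^sup>+ \<theta>. R n \<theta> \<partial>lborel) \<le> ennreal (pi / 2 * C)" for n
  proof -
    have "(\<integral>\<^sup>+ \<theta>. R n \<theta> \<partial>lborel) = ennreal (integral {\<delta> n..pi - \<delta> n} (q n))"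
      unfolding R_def using arc(1)
      by (intro nn_integral_has_integral_lebesgue' integrable_integral integrable_continuous_real)
         (auto simp: q_def)
    also have "\<dots> \<le> ennreal (pi / 2 * C)" by (intro ennreal_leI arc(2))
    finally show ?thesis .
  qed
  have meas: "R n \<in> borel_measurable lborel" for n
  proof -
    have "(\<lambda>\<theta>. indicator {\<delta> n..pi - \<delta> n} \<theta> *\<^sub>R q n \<theta>) \<in> borel_measurable borel"
      by (rule borel_measurable_continuous_on_indicator[OF _ arc(1)]) simp
    then have "(\<lambda>\<theta>. ennreal (indicator {\<delta> n..pi - \<delta> n} \<theta> *\<^sub>R q n \<theta>)) \<in> borel_measurable borel"
      by measurable
    moreover have "(\<lambda>\<theta>. ennreal (indicator {\<delta> n..pi - \<delta> n} \<theta> *\<^sub>R q n \<theta>)) = R n"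
      by (auto simp: R_def fun_eq_iff split: split_indicator)
    ultimately show ?thesis by simp
  qed
  have lim: "liminf (\<lambda>n. R n \<theta>) = ?P \<theta> * indicator {0<..<pi} \<theta>" for \<theta>
  proof (cases "\<theta> \<in> {0<..<pi}")
    case False
    then have "R n \<theta> = 0" for n using \<delta>[of n] by (auto simp: R_def split: split_indicator)
    with False show ?thesis by (simp add: Liminf_const)
  next
    case True
    then have \<theta>: "0 < \<theta>" "\<theta> < pi" by auto
    have bv: "(\<lambda>n. g (Complex (log_tan_half \<theta>) (k n))) \<longlonglongrightarrow> boundary_value f (\<zeta> * \<eta>)"
      if "(\<lambda>n. disc_of_strip (Complex (log_tan_half \<theta>) (k n))) \<longlonglongrightarrow> \<zeta>" "norm \<zeta> = 1"
        "\<And>n. \<bar>k n\<bar> < pi / 2" for k \<zeta>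
      unfolding g_def to_strip_def
    proof (rule boundary_value_sequentially[OF f F])
      show "norm (\<zeta> * \<eta>) = 1" using that \<eta> by (simp add: norm_mult)
      show "(\<lambda>n. \<eta> * disc_of_strip (Complex (log_tan_half \<theta>) (k n))) \<longlonglongrightarrow> \<zeta> * \<eta>"
        using tendsto_mult_left[OF that(1), of \<eta>] by (simp add: mult.commute)
      show "norm (\<eta> * disc_of_strip (Complex (log_tan_half \<theta>) (k n))) < 1" for n
        using disc_of_strip_in_ball[OF Complex_in_strip[OF that(3)]] \<eta> by (simp add: norm_mult)
    qed
    have h': "\<bar>h n\<bar> < pi / 2" "\<bar>- h n\<bar> < pi / 2" for n using h[of n] by simp_all
    have n0: "norm (1 - cis \<theta>) \<noteq> 0"
      using half_angle_pos(4)[OF \<theta>] by (auto simp: complex_eq_iff)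
    have "(\<lambda>n. q n \<theta>) \<longlonglongrightarrow> norm (boundary_value f (cis (- \<theta>) * \<eta>) - boundary_value f (cis \<theta> * \<eta>)) / norm (1 - cis \<theta>)"
      unfolding q_def using h'
      by (intro tendsto_intros n0 bv disc_of_strip_tendsto_edges[OF \<theta> hlim]) auto
    then have "(\<lambda>n. ennreal (q n \<theta>)) \<longlonglongrightarrow> ?P \<theta>"
      by (intro tendsto_ennrealI) (simp add: norm_minus_commute)
    moreover have "eventually (\<lambda>n. ennreal (q n \<theta>) = R n \<theta>) sequentially"
    proof -
      have "eventually (\<lambda>n. \<delta> n < min \<theta> (pi - \<theta>)) sequentially"
        using \<theta> by (intro order_tendstoD(2)[OF \<delta>lim]) auto
      then show ?thesis by eventually_elim (auto simp: R_def)
    qed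
    ultimately have "(\<lambda>n. R n \<theta>) \<longlonglongrightarrow> ?P \<theta>"
      by (rule Lim_transform_eventually)
    then show ?thesis using True by (simp add: lim_imp_Liminf)
  qed
  have "(\<integral>\<^sup>+ \<theta>. ?P \<theta> * indicator {0<..<pi} \<theta> \<partial>lborel) = (\<integral>\<^sup>+ \<theta>. liminf (\<lambda>n. R n \<theta>) \<partial>lborel)"
    by (simp add: lim)
  also have "\<dots> \<le> liminf (\<lambda>n. \<integral>\<^sup>+ \<theta>. R n \<theta> \<partial>lborel)"
    by (rule nn_integral_liminf[OF meas])
  also have "\<dots> \<le> liminf (\<lambda>n::nat. ennreal (pi / 2 * C))"
    using int by (intro Liminf_mono always_eventually) auto
  also have "\<dots> = ennreal (pi\<^sup>2 * hardy_norm 1 (deriv f))"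
    by (simp add: Liminf_const C_def power2_eq_square mult.assoc)
  finally show ?thesis .
qed

text \<open>
  The boundary values are pointwise limits of continuous functions \<open>\<zeta> \<mapsto> f (r * k \<zeta>)\<close> as \<open>r \<rightarrow> 1\<close>.
\<close>
lemma boundary_value_measurable:
  fixes k :: "complex \<Rightarrow> complex"
  assumes f: "f holomorphic_on ball 0 1" and F: "deriv f \<in> hardy_space 1"
    and k: "continuous_on (sphere 0 1) k" "\<And>\<zeta>. \<zeta> \<in> sphere 0 1 \<Longrightarrow> norm (k \<zeta>) = 1"
  shows "(\<lambda>\<zeta>. boundary_value f (k \<zeta>)) \<in> borel_measurable (restrict_space borel (sphere 0 1))"
proof (rule borel_measurable_LIMSEQ_metric)
  define r where "r n = 1 - 1 / real (Suc n)" for n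
  have r: "0 \<le> r n" "r n < 1" for n by (auto simp: r_def)
  have rl: "r \<longlonglongrightarrow> 1"
    unfolding r_def using tendsto_diff[OF tendsto_const lim_inverse_n'[THEN LIMSEQ_Suc]] by simp
  show "(\<lambda>\<zeta>. f (of_real (r n) * k \<zeta>)) \<in> borel_measurable (restrict_space borel (sphere 0 1))" for n
    using r[of n] k
    by (intro borel_measurable_continuous_on_restrict
        continuous_on_compose2[OF holomorphic_on_imp_continuous_on[OF f]] continuous_intros)
       (auto simp: norm_mult)
  fix \<zeta> :: complex assume "\<zeta> \<in> space (restrict_space borel (sphere 0 1))"
  then have \<zeta>: "norm (k \<zeta>) = 1" using k(2) by (auto simp: space_restrict_space)
  show "(\<lambda>n. f (of_real (r n) * k \<zeta>)) \<longlonglongrightarrow> boundary_value f (k \<zeta>)"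
  proof (rule boundary_value_sequentially[OF f F \<zeta>])
    show "(\<lambda>n. of_real (r n) * k \<zeta>) \<longlonglongrightarrow> k \<zeta>"
      using tendsto_mult[OF tendsto_of_real[OF rl] tendsto_const, of "k \<zeta>"] by simp
    show "norm (of_real (r n) * k \<zeta>) < 1" for n using r[of n] \<zeta> by (simp add: norm_mult)
  qed
qed

theorem theorem1:
  fixes f :: "complex \<Rightarrow> complex" and \<eta> :: complex
  assumes "f holomorphic_on ball 0 1"
    and "deriv f \<in> hardy_space 1"
    and "\<eta> \<in> sphere 0 1"
  shows "(\<integral>\<^sup>+ \<zeta>. ennreal (norm (boundary_value f (\<zeta> * \<eta>) - boundary_value f (cnj \<zeta> * \<eta>))
             / norm (1 - \<zeta>)) \<partial>circle_measure)
         \<le> ennreal (pi * hardy_norm 1 (deriv f))"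
proof -
  note f = assms(1) and F = assms(2)
  have \<eta>: "norm \<eta> = 1" using assms(3) by simp
  define \<Phi> where "\<Phi> \<zeta> = ennreal (norm (boundary_value f (\<zeta> * \<eta>) - boundary_value f (cnj \<zeta> * \<eta>))
      / norm (1 - \<zeta>))" for \<zeta>
  define N where "N = hardy_norm 1 (deriv f)"
  have N0: "0 \<le> N"
    using bounded_line_variation_nonneg[OF bounded_line_variation_to_strip[OF f F \<eta>]]
    pi_gt_zero
    by (auto simp: N_def zero_le_mult_iff)
  have \<Phi>m: "\<Phi> \<in> borel_measurable (restrict_space borel (sphere 0 1))"
  proof -
    have m: "(\<lambda>\<zeta>. boundary_value f (\<zeta> * \<eta>)) \<in> borel_measurable (restrict_space borel (sphere 0 1))"
      "(\<lambda>\<zeta>. boundary_value f (cnj \<zeta> * \<eta>)) \<in> borel_measurable (restrict_space borel (sphere 0 1))"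
      using \<eta> by (auto intro!: boundary_value_measurable[OF f F] continuous_intros simp: norm_mult)
    have "(\<lambda>\<zeta>. norm (1 - \<zeta>)) \<in> borel_measurable (restrict_space borel (sphere (0::complex) 1))"
      by (intro borel_measurable_continuous_on_restrict continuous_intros)
    with m show ?thesis unfolding \<Phi>_def by measurable
  qed
  define P where "P t = \<Phi> (cis t)" for t
  have "cis \<in> measurable borel (restrict_space borel (sphere 0 1))"
    by (rule measurable_restrict_space2)
       (auto intro!: borel_measurable_continuous_onI continuous_intros)
  then have Pm [measurable]: "P \<in> borel_measurable borel"
    unfolding P_def using \<Phi>m by (rule measurable_compose)
  \<comment> \<open>The integrand is invariant under \<open>\<zeta> \<mapsto> cnj \<zeta>\<close>, so both half circles contribute equally.\<close>
  have sym: "P (2 * pi + (- 1) * t) = P t" for t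
  proof -
    have "cis (2 * pi + (- 1) * t) = cnj (cis t)"
      by (simp add: complex_eq_iff cos_2pi_minus sin_2pi_minus)
    moreover have "norm (1 - cnj (cis t)) = norm (1 - cis t)"
      by (metis complex_cnj_diff complex_cnj_one complex_mod_cnj)
    ultimately show ?thesis by (simp only: P_def \<Phi>_def norm_minus_commute complex_cnj_cnj)
  qed
  define X where "X = (\<integral>\<^sup>+ t. P t * indicator {0<..<pi} t \<partial>lborel)"
  have X: "X \<le> ennreal (pi\<^sup>2 * N)"
    using half_circle_bound[OF f F \<eta>] by (simp add: X_def P_def \<Phi>_def N_def cis_cnj)
  have "(\<integral>\<^sup>+ t. P t * indicator {pi<..<2 * pi} t \<partial>lborel)
      = (\<integral>\<^sup>+ t. P (2 * pi + (- 1) * t) * indicator {pi<..<2 * pi} (2 * pi + (- 1) * t) \<partial>lborel)"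
    by (subst nn_integral_real_affine[where c = "-1" and t = "2 * pi"]) auto
  also have "\<dots> = X"
    unfolding X_def sym by (intro nn_integral_cong) (auto split: split_indicator)
  finally have X': "(\<integral>\<^sup>+ t. P t * indicator {pi<..<2 * pi} t \<partial>lborel) = X" .
  have "(\<integral>\<^sup>+ t. P t * indicator {0..2 * pi} t \<partial>lborel)
      = (\<integral>\<^sup>+ t. P t * indicator {0<..<pi} t + P t * indicator {pi<..<2 * pi} t \<partial>lborel)"
  proof (rule nn_integral_cong_AE)
    have "AE t in lborel. t \<notin> {0, pi, 2 * pi}"
      by (intro AE_not_in finite_imp_null_set_lborel) auto
    then show "AE t in lborel. P t * indicator {0..2 * pi} t
        = P t * indicator {0<..<pi} t + P t * indicator {pi<..<2 * pi} t"
      by eventually_elim (auto split: split_indicator)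
  qed
  also have "\<dots> = X + X"
    by (subst nn_integral_add) (auto simp: X' simp flip: X_def)
  also have "\<dots> \<le> ennreal (pi\<^sup>2 * N) + ennreal (pi\<^sup>2 * N)"
    by (intro add_mono X)
  also have "\<dots> = ennreal (2 * pi * (pi * N))"
    using N0 by (subst ennreal_plus[symmetric]) (auto simp: power2_eq_square)
  finally have le: "(\<integral>\<^sup>+ t. P t * indicator {0..2 * pi} t \<partial>lborel) \<le> ennreal (2 * pi * (pi * N))" .
  have "(\<integral>\<^sup>+ \<zeta>. \<Phi> \<zeta> \<partial>circle_measure) \<le> ennreal (2 * pi * (pi * N)) / ennreal (2 * pi)"
    unfolding circle_measure_nn_integral[OF \<Phi>m]
    by (intro divide_right_mono_ennreal) (use le in \<open>simp add: P_def\<close>)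
  also have "\<dots> = ennreal (pi * N)"
    using N0 by (subst divide_ennreal) auto
  finally show ?thesis by (simp add: \<Phi>_def N_def)
qed

end
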